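(* Let $N\in\mathbb N_0$, $\alpha_1,\alpha_2,\beta>-1$, $(n_1,n_2)\in\mathbb N_0^2$. Let $\omega_1,\omega_2$ be the Hahn weights, assumed to form an algebraic Chebyshev (AT) system, and let $Q^{(1)}_{(n_1,n_2)},Q^{(2)}_{(n_1,n_2)}$ be the polynomials defined by the explicit formula in the context. Then $$\sum_{k=0}^N\Big(Q^{(1)}_{(n_1,n_2)}(k)\,\omega_1(k)+Q^{(2)}_{(n_1,n_2)}(k)\,\omega_2(k)\Big)(-N+k)_j=0\qquad\text{for } j\in\{0,\dots,n_1+n_2-2\},$$ and $$\sum_{k=0}^N\Big(Q^{(1)}_{(n_1,n_2)}(k)\,\omega_1(k)+Q^{(2)}_{(n_1,n_2)}(k)\,\omega_2(k)\Big)(-N+k)_{n_1+n_2-1}=1.$$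
   Context: Pochhammer symbol: $(x)_n=\Gamma(x+n)/\Gamma(x)$, i.e. $(x)_0=1$, $(x)_n=x(x+1)\cdots(x+n-1)$. Hahn weights, for $a\in\{1,2\}$ and $x\in\{0,\dots,N\}$: $$\omega_a(x)=\frac{\Gamma(\alpha_a+x+1)}{\Gamma(\alpha_a+1)\Gamma(x+1)}\,\frac{\Gamma(\beta+N-x+1)}{\Gamma(\beta+1)\Gamma(N-x+1)}.$$ Notation: $\hat\alpha_1=\alpha_2$, $\hat\alpha_2=\alpha_1$, $\hat n_1=n_2$, $\hat n_2=n_1$. For $a\in\{1,2\}$ define $$Q^{(a)}_{(n_1,n_2)}(x)=\sum_{l=0}^{n_a-1}C^{(a),l}_{(n_1,n_2)}\,(-x)_l,$$ $$C^{(a),l}_{(n_1,n_2)}=K_a\,\frac{(\alpha_a+\beta+n_1+n_2)_l\,(\alpha_a-\hat\alpha_a-\hat n_a+1)_l}{l!\,(\alpha_a+1)_l\,(-N)_l}\sum_{m=0}^{n_a-1-l}\frac{(-n_a+1)_{l+m}\,(-N)_{l+m}\,(\hat\alpha_a-\alpha_a-n_a+1)_m}{m!\,(-n_1-n_2+2)_{l+m}\,(\hat\alpha_a+\beta+\hat n_a+1)_{l+m}},$$ $$K_a=\frac{(-1)^{n_a-1}(N+1-n_1-n_2)!\,(n_1+n_2-2)!}{(n_1-1)!\,(n_2-1)!\,(\beta+1)_{n_1+n_2-1}\,(\alpha_a+\beta+n_1+n_2+n_a)_{N+1-n_1-n_2}}\;\frac{(\hat\alpha_a+\beta+\hat n_a+1)_{n_1+n_2-1}}{(\alpha_a-\hat\alpha_a-\hat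 n_a+1)_{n_1+n_2-1}}.$$
   Formalization: Assumes 1 ≤ n_1+n_2 ≤ N+1 (otherwise K_a is undefined, and at (0,0) both Q vanish, so the second sum is not 1); if one index is 0, where the printed formula has 1/(-1)! against a zero denominator, the other Q is given by the formula after cancellation. *)

theory Defs
  imports "HOL-Analysis.Analysis" "HOL-Computational_Algebra.Polynomial"
begin

text \<open>
  A pair of weights on the nodes \<open>0, \<dots>, N\<close> is an algebraic Chebyshev (AT) system if for every
  multi-index \<open>(n\<^sub>1, n\<^sub>2)\<close> the \<open>n\<^sub>1 + n\<^sub>2\<close> functions
  \<open>w\<^sub>1, x w\<^sub>1, \<dots>, x^(n\<^sub>1-1) w\<^sub>1, w\<^sub>2, x w\<^sub>2, \<dots>, x^(n\<^sub>2-1) w\<^sub>2\<close> form a Chebyshev system on the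
  nodes: a nontrivial linear combination has at most \<open>n\<^sub>1 + n\<^sub>2 - 1\<close> zeros there.
  The condition says nothing for \<open>n\<^sub>1 + n\<^sub>2 > N + 1\<close>, there being only \<open>N + 1\<close> nodes.
\<close>

definition chebyshev_index :: "nat \<Rightarrow> (nat \<Rightarrow> real) \<Rightarrow> (nat \<Rightarrow> real) \<Rightarrow> nat \<Rightarrow> nat \<Rightarrow> bool" where
  "chebyshev_index N w1 w2 n1 n2 \<longleftrightarrow>
     (\<forall>p1 p2 :: real poly.
        (p1 = 0 \<or> degree p1 < n1) \<longrightarrow> (p2 = 0 \<or> degree p2 < n2) \<longrightarrow> (p1, p2) \<noteq> (0, 0) \<longrightarrow>
        card {x \<in> {0..N}. poly p1 (real x) * w1 x + poly p2 (real x) * w2 x = 0} \<le> n1 + n2 - 1)"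

definition AT_system :: "nat \<Rightarrow> (nat \<Rightarrow> real) \<Rightarrow> (nat \<Rightarrow> real) \<Rightarrow> bool" where
  "AT_system N w1 w2 \<longleftrightarrow> (\<forall>n1 n2. chebyshev_index N w1 w2 n1 n2)"

definition hahn_weight :: "nat \<Rightarrow> real \<Rightarrow> real \<Rightarrow> nat \<Rightarrow> real" where
  "hahn_weight N \<beta> \<alpha> x =
     Gamma (\<alpha> + real x + 1) / (Gamma (\<alpha> + 1) * Gamma (real x + 1)) *
     (Gamma (\<beta> + real N - real x + 1) / (Gamma (\<beta> + 1) * Gamma (real N - real x + 1)))"

text \<open>
  In the definitions below, \<open>\<alpha>, n\<close> are the parameter and the index belonging to the component \<open>a\<close>
  under consideration, and \<open>\<alpha>', n'\<close> those of the other component (written with a hat in the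
  mathematical notation). The expressions symmetric in the two indices are unaffected by this.
\<close>

definition hahn_K :: "nat \<Rightarrow> real \<Rightarrow> real \<Rightarrow> real \<Rightarrow> nat \<Rightarrow> nat \<Rightarrow> real" where
  "hahn_K N \<beta> \<alpha> \<alpha>' n n' =
     (-1) ^ (n - 1) * fact (N + 1 - n - n') * fact (n + n' - 2) /
       (fact (n - 1) * fact (n' - 1) * pochhammer (\<beta> + 1) (n + n' - 1) *
        pochhammer (\<alpha> + \<beta> + real n + real n' + real n) (N + 1 - n - n')) *
     (pochhammer (\<alpha>' + \<beta> + real n' + 1) (n + n' - 1) /
        pochhammer (\<alpha> - \<alpha>' - real n' + 1) (n + n' - 1))"

text \<open>The coefficients \<open>C\<close> for \<open>n, n' \<ge> 1\<close>:\<close>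

definition hahn_C :: "nat \<Rightarrow> real \<Rightarrow> real \<Rightarrow> real \<Rightarrow> nat \<Rightarrow> nat \<Rightarrow> nat \<Rightarrow> real" where
  "hahn_C N \<beta> \<alpha> \<alpha>' n n' l =
     hahn_K N \<beta> \<alpha> \<alpha>' n n' *
     (pochhammer (\<alpha> + \<beta> + real n + real n') l * pochhammer (\<alpha> - \<alpha>' - real n' + 1) l /
       (fact l * pochhammer (\<alpha> + 1) l * pochhammer (- real N) l)) *
     (\<Sum>m = 0..n - 1 - l.
        pochhammer (- real n + 1) (l + m) * pochhammer (- real N) (l + m) *
          pochhammer (\<alpha>' - \<alpha> - real n + 1) m /
        (fact m * pochhammer (- real n - real n' + 2) (l + m) *
          pochhammer (\<alpha>' + \<beta> + real n' + 1) (l + m)))"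

text \<open>
  If \<open>n' = 0\<close>, the formula for \<open>C\<close> contains both \<open>1 / (n' - 1)! = 0\<close> and a factor
  \<open>1 / (-n - n' + 2)\<^sub>l\<^sub>+\<^sub>m\<close> whose denominator vanishes for \<open>l + m = n - 1\<close>. It has to be read by cancelling first:
  \<open>(n + n' - 2)! / ((n' - 1)! (-n - n' + 2)\<^sub>j) = (-1)\<^sup>j (n')\<^sub>n\<^sub>-\<^sub>1\<^sub>-\<^sub>j\<close> for \<open>j \<le> n - 1\<close>.
  At \<open>n' = 0\<close> this leaves only the summand \<open>m = n - 1 - l\<close>, in which all factors containing
  \<open>\<alpha>'\<close> cancel, because \<open>(\<alpha>' - \<alpha> - n + 1)\<^sub>m = (-1)\<^sup>m (\<alpha> - \<alpha>' + 1 + l)\<^sub>m\<close>.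
  The result, stated in the next definition, is the coefficient of a multiple of the classical
  Hahn polynomial of degree \<open>n - 1\<close>.
\<close>

definition hahn_C0 :: "nat \<Rightarrow> real \<Rightarrow> real \<Rightarrow> nat \<Rightarrow> nat \<Rightarrow> real" where
  "hahn_C0 N \<beta> \<alpha> n l =
     (-1) ^ (n - 1) * fact N /
       (fact (n - 1) * pochhammer (\<beta> + 1) (n - 1) *
        pochhammer (\<alpha> + \<beta> + 2 * real n) (N + 1 - n)) *
     (pochhammer (- real n + 1) l * pochhammer (\<alpha> + \<beta> + real n) l /
       (fact l * pochhammer (\<alpha> + 1) l * pochhammer (- real N) l))"

text \<open>For \<open>n = 0\<close> the sum is empty, so the polynomial is \<open>0\<close>.\<close>

definition hahn_Q :: "nat \<Rightarrow> real \<Rightarrow> real \<Rightarrow> real \<Rightarrow> nat \<Rightarrow> nat \<Rightarrow> real \<Rightarrow> real" where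
  "hahn_Q N \<beta> \<alpha> \<alpha>' n n' x =
     (\<Sum>l<n. (if n' = 0 then hahn_C0 N \<beta> \<alpha> n l else hahn_C N \<beta> \<alpha> \<alpha>' n n' l) * pochhammer (- x) l)"

end

theory Submission
  imports Defs
begin

text \<open>
  The function \<open>Q \<omega>\<close> with \<open>Q\<close> of degree less than \<open>n\<close> is a combination of the Hahn weights with
  parameters \<open>\<alpha>, \<dots>, \<alpha> + n - 1\<close>. By Chu-Vandermonde the moment against \<open>(-N + k)\<^sub>j\<close> of the weight with
  parameter \<open>t\<close> is a constant times \<open>(t + \<beta> + 2 + j)\<^bsub>N-j\<^esub>\<close>. Let \<open>X\<close> be the set of the \<open>n\<^sub>1 + n\<^sub>2\<close> shifted
  parameters and let the coefficient of the weight with parameter \<open>x \<in> X\<close> be the residue at \<open>x\<close> of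
  \<open>1 / ((t + \<beta> + n\<^sub>1 + n\<^sub>2)\<^bsub>N+2-n\<^sub>1-n\<^sub>2\<^esub> \<Prod>\<^bsub>y\<in>X\<^esub> (t - y))\<close>. Then the \<open>j\<close>-th moment of the whole form is a sum of
  values \<open>p(x) / \<Prod>\<^bsub>y\<noteq>x\<^esub> (x - y)\<close> with \<open>p\<close> a polynomial of degree \<open>n\<^sub>1 + n\<^sub>2 - 2 - j\<close>, which vanishes; for
  \<open>j = n\<^sub>1 + n\<^sub>2 - 1\<close> one further simple pole remains and gives the normalisation. The coefficients of this
  form in the basis \<open>(-x)\<^sub>l\<close> are terminating \<open>\<^sub>3F\<^sub>2(1)\<close> sums; reversing the summation and applying
  twice a transformation of Sheppard type turns them into the stated ones. The AT condition enters only
  through \<open>\<alpha>\<^sub>1 + i \<noteq> \<alpha>\<^sub>2 + j\<close>, which keeps the poles simple and the denominators nonzero.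
\<close>

subsection \<open>Terminating hypergeometric sums\<close>

lemma pochhammer_reflect:
  fixes a :: "'a::comm_ring_1"
  shows "pochhammer (1 - a - of_nat n) n = (-1) ^ n * pochhammer a n"
  using pochhammer_minus'[of "- a" n] by (simp add: algebra_simps)

lemma sum_swap_triangle:
  fixes f :: "nat \<Rightarrow> nat \<Rightarrow> 'a::comm_monoid_add"
  shows "(\<Sum>m\<le>n. \<Sum>i\<le>m. f m i) = (\<Sum>i\<le>n. \<Sum>m=i..n. f m i)"
  by (induction n) (auto simp: sum.distrib)

text \<open>The terminating Chu-Vandermonde sum, multiplied by \<open>pochhammer e n\<close> so that
  no division occurs. It is the binomial theorem for rising factorials with arguments
  \<open>c\<close> and \<open>1 - e - n\<close>, whose second factor is then reflected.\<close>

lemma pochhammer_Vandermonde: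
  fixes c e :: "'a::comm_ring_1"
  shows "(\<Sum>i\<le>n. (-1) ^ i * of_nat (n choose i) * pochhammer c i * pochhammer (e + of_nat i) (n - i))
         = pochhammer (e - c) n"
proof -
  have *: "pochhammer (1 - e - of_nat n) (n - i) = (-1) ^ (n - i) * pochhammer (e + of_nat i) (n - i)"
    if "i \<le> n" for i
    using pochhammer_reflect[of "e + of_nat i" "n - i"] that by (simp add: of_nat_diff algebra_simps)
  have sgn: "(-1) ^ n * (-1) ^ (n - i) = ((-1) ^ i :: 'a)" if "i \<le> n" for i
    using that by (metis (no_types, opaque_lifting) le_add_diff_inverse left_minus_one_mult_self mult.commute power_add)
  have "pochhammer (e - c) n = (-1) ^ n * pochhammer (1 - (e - c) - of_nat n) n"
    by (simp add: pochhammer_reflect)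
  also have "1 - (e - c) - of_nat n = c + (1 - e - of_nat n)" by simp
  also have "(-1) ^ n * pochhammer (c + (1 - e - of_nat n)) n
      = (\<Sum>i\<le>n. (-1) ^ n * (-1) ^ (n - i) * of_nat (n choose i) * pochhammer c i
           * pochhammer (e + of_nat i) (n - i))"
    unfolding pochhammer_binomial_sum[of c] sum_distrib_left
    by (intro sum.cong refl) (simp add: * mult_ac)
  also have "\<dots> = (\<Sum>i\<le>n. (-1) ^ i * of_nat (n choose i) * pochhammer c i * pochhammer (e + of_nat i) (n - i))"
    by (intro sum.cong refl) (simp add: sgn)
  finally show ?thesis by simp
qed

text \<open>
  The terminating hypergeometric sum \<open>\<^sub>3F\<^sub>2(-n, a, b; d, e; 1)\<close> multiplied by \<open>(d)\<^sub>n (e)\<^sub>n\<close>. In this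
  normalisation nothing is divided, so its transformations hold for all parameters.
\<close>

definition hyp3F2 :: "nat \<Rightarrow> 'a::comm_ring_1 \<Rightarrow> 'a \<Rightarrow> 'a \<Rightarrow> 'a \<Rightarrow> 'a" where
  "hyp3F2 n a b d e = (\<Sum>m\<le>n. (-1) ^ m * of_nat (n choose m) * pochhammer a m * pochhammer b m
      * pochhammer (d + of_nat m) (n - m) * pochhammer (e + of_nat m) (n - m))"

lemma hyp3F2_commute: "hyp3F2 n a b d e = hyp3F2 n b a d e" "hyp3F2 n a b d e = hyp3F2 n a b e d"
  by (simp_all add: hyp3F2_def mult_ac)

text \<open>Reading the sum backwards and reflecting every Pochhammer symbol exchanges numerator and
  denominator parameters. The four reflection signs cancel in pairs, so only the
  \<open>(-1)^(n - m)\<close> of the summand itself survives.\<close>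

lemma hyp3F2_reverse:
  fixes a :: "'a::comm_ring_1"
  shows "hyp3F2 n a b d e
    = (-1) ^ n * hyp3F2 n (1 - d - of_nat n) (1 - e - of_nat n) (1 - a - of_nat n) (1 - b - of_nat n)"
proof -
  have up: "pochhammer (d + of_nat (n - m)) m = (-1) ^ m * pochhammer (1 - d - of_nat n) m"
    if "m \<le> n" for m and d :: 'a
    using pochhammer_reflect[of "1 - d - of_nat n" m] that
    by (simp add: of_nat_diff algebra_simps)
  have low: "pochhammer a (n - m) = (-1) ^ (n - m) * pochhammer (1 - a - of_nat n + of_nat m) (n - m)"
    if "m \<le> n" for m and a :: 'a
    using pochhammer_reflect[of "a" "n - m"] that
    by (simp add: of_nat_diff algebra_simps)
  have sgn: "(-1) ^ (n - m) = (-1) ^ n * ((-1) ^ m :: 'a)" if "m \<le> n" for m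
    using that by (metis (no_types, opaque_lifting) le_add_diff_inverse2 left_minus_one_mult_self mult.commute power_add)
  have "hyp3F2 n a b d e = (\<Sum>m\<le>n. (-1) ^ (n - m) * of_nat (n choose (n - m)) * pochhammer a (n - m) * pochhammer b (n - m)
      * pochhammer (d + of_nat (n - m)) (n - (n - m)) * pochhammer (e + of_nat (n - m)) (n - (n - m)))"
    unfolding hyp3F2_def
    by (rule sum.reindex_bij_witness[of _ "\<lambda>m. n - m" "\<lambda>m. n - m"]) auto
  also have "\<dots> = (\<Sum>m\<le>n. (-1) ^ n * ((-1) ^ m * of_nat (n choose m) * pochhammer (1 - d - of_nat n) m
      * pochhammer (1 - e - of_nat n) m
      * pochhammer (1 - a - of_nat n + of_nat m) (n - m) * pochhammer (1 - b - of_nat n + of_nat m) (n - m)))"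
  proof (intro sum.cong refl)
    fix m assume "m \<in> {..n}"
    then have "m \<le> n" by simp
    then show "(-1) ^ (n - m) * of_nat (n choose (n - m)) * pochhammer a (n - m) * pochhammer b (n - m)
      * pochhammer (d + of_nat (n - m)) (n - (n - m)) * pochhammer (e + of_nat (n - m)) (n - (n - m))
      = (-1) ^ n * ((-1) ^ m * of_nat (n choose m) * pochhammer (1 - d - of_nat n) m
      * pochhammer (1 - e - of_nat n) m
      * pochhammer (1 - a - of_nat n + of_nat m) (n - m) * pochhammer (1 - b - of_nat n + of_nat m) (n - m))"
      by (simp add: low[of m a] low[of m b] up[of m d] up[of m e] sgn binomial_symmetric[symmetric] mult_ac
            del: of_nat_diff)
  qed
  finally show ?thesis by (simp add: hyp3F2_def sum_distrib_left)
qed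

text \<open>A transformation of Sheppard type. Expanding the \<open>b\<close>-factor by
  Chu-Vandermonde in terms of \<open>e - b\<close> and exchanging the summations leaves an inner sum
  in \<open>a\<close> and \<open>d\<close>, to which Chu-Vandermonde applies again.\<close>

lemma hyp3F2_transform:
  fixes a :: "'a::comm_ring_1"
  shows "hyp3F2 n a b d e = (-1) ^ n * hyp3F2 n a (e - b) e (1 + a - d - of_nat n)"
proof -
  have b: "pochhammer b m * pochhammer (e + of_nat m) (n - m)
      = (\<Sum>i\<le>m. (-1) ^ i * of_nat (m choose i) * pochhammer (e - b) i * pochhammer (e + of_nat i) (n - i))"
    if "m \<le> n" for m
  proof -
    have split: "pochhammer (e + of_nat i) (n - i)
        = pochhammer (e + of_nat i) (m - i) * pochhammer (e + of_nat m) (n - m)" if "i \<le> m" for i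
      using pochhammer_product[of "m - i" "n - i" "e + of_nat i"] that \<open>m \<le> n\<close>
      by (simp add: of_nat_diff)
    have "pochhammer b m = (\<Sum>i\<le>m. (-1) ^ i * of_nat (m choose i) * pochhammer (e - b) i
        * pochhammer (e + of_nat i) (m - i))"
      using pochhammer_Vandermonde[of m "e - b" e] by simp
    then have "pochhammer b m * pochhammer (e + of_nat m) (n - m)
      = (\<Sum>i\<le>m. (-1) ^ i * of_nat (m choose i) * pochhammer (e - b) i
          * (pochhammer (e + of_nat i) (m - i) * pochhammer (e + of_nat m) (n - m)))"
      by (simp only: sum_distrib_right mult.assoc)
    also have "\<dots> = (\<Sum>i\<le>m. (-1) ^ i * of_nat (m choose i) * pochhammer (e - b) i
          * pochhammer (e + of_nat i) (n - i))"
      by (intro sum.cong refl) (simp only: split[symmetric] atMost_iff)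
    finally show ?thesis .
  qed
  \<comment> \<open>Trinomial revision of the two binomial coefficients pulls out
    \<open>n choose i\<close>; the shift \<open>m = p + i\<close> then leaves a Chu-Vandermonde sum
    of length \<open>n - i\<close>.\<close>
  have inner: "(\<Sum>m=i..n. (-1) ^ m * (-1) ^ i * of_nat (n choose m) * of_nat (m choose i) * pochhammer a m
        * pochhammer (d + of_nat m) (n - m))
      = of_nat (n choose i) * pochhammer a i * pochhammer (d - a) (n - i)" if "i \<le> n" for i
  proof -
    have "(\<Sum>m=i..n. (-1) ^ m * (-1) ^ i * of_nat (n choose m) * of_nat (m choose i) * pochhammer a m
        * pochhammer (d + of_nat m) (n - m))
      = (\<Sum>p\<le>n - i. (-1) ^ (p + i) * (-1) ^ i * of_nat (n choose (p + i)) * of_nat ((p + i) choose i) * pochhammer a (p + i)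
        * pochhammer (d + of_nat (p + i)) (n - (p + i)))"
      using that by (intro sum.reindex_bij_witness[of _ "\<lambda>p. p + i" "\<lambda>m. m - i"]) auto
    also have "\<dots> = (\<Sum>p\<le>n - i. of_nat (n choose i) * pochhammer a i * ((-1) ^ p * of_nat ((n - i) choose p)
         * pochhammer (a + of_nat i) p * pochhammer ((d + of_nat i) + of_nat p) (n - i - p)))"
    proof (intro sum.cong refl)
      fix p assume "p \<in> {..n - i}"
      then have p: "p + i \<le> n" using that by auto
      have c: "of_nat (n choose (p + i)) * of_nat ((p + i) choose i)
          = (of_nat (n choose i) * of_nat ((n - i) choose p) :: 'a)"
        using choose_mult[of i "p + i" n] p by (metis add_diff_cancel_right' le_add2 of_nat_mult)
      have s: "(-1) ^ (p + i) * (-1) ^ i = ((-1) ^ p :: 'a)"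
        by (simp add: power_add mult.assoc)
      have q: "pochhammer a (p + i) = pochhammer a i * pochhammer (a + of_nat i) p"
        by (metis add.commute pochhammer_product')
      have r: "pochhammer (d + of_nat (p + i)) (n - (p + i)) = pochhammer ((d + of_nat i) + of_nat p) (n - i - p)"
        by (simp add: add_ac)
      have "(-1) ^ (p + i) * (-1) ^ i * of_nat (n choose (p + i)) * of_nat ((p + i) choose i) * pochhammer a (p + i)
        * pochhammer (d + of_nat (p + i)) (n - (p + i))
        = ((-1) ^ (p + i) * (-1) ^ i) * (of_nat (n choose (p + i)) * of_nat ((p + i) choose i)) * pochhammer a (p + i)
        * pochhammer (d + of_nat (p + i)) (n - (p + i))" by (simp only: mult.assoc)
      then show "(-1) ^ (p + i) * (-1) ^ i * of_nat (n choose (p + i)) * of_nat ((p + i) choose i) * pochhammer a (p + i)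
        * pochhammer (d + of_nat (p + i)) (n - (p + i))
       = of_nat (n choose i) * pochhammer a i * ((-1) ^ p * of_nat ((n - i) choose p)
         * pochhammer (a + of_nat i) p * pochhammer ((d + of_nat i) + of_nat p) (n - i - p))"
        unfolding c s q r by (simp only: mult_ac)
    qed
    also have "\<dots> = of_nat (n choose i) * pochhammer a i * pochhammer (d - a) (n - i)"
      using pochhammer_Vandermonde[of "n - i" "a + of_nat i" "d + of_nat i"]
      by (simp add: sum_distrib_left[symmetric])
    finally show ?thesis .
  qed
  have "hyp3F2 n a b d e = (\<Sum>m\<le>n. (-1) ^ m * of_nat (n choose m) * pochhammer a m
      * pochhammer (d + of_nat m) (n - m) * (pochhammer b m * pochhammer (e + of_nat m) (n - m)))"
    by (simp add: hyp3F2_def mult_ac)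
  also have "\<dots> = (\<Sum>m\<le>n. \<Sum>i\<le>m. (pochhammer (e - b) i * pochhammer (e + of_nat i) (n - i)) *
      ((-1) ^ m * (-1) ^ i * of_nat (n choose m) * of_nat (m choose i) * pochhammer a m
        * pochhammer (d + of_nat m) (n - m)))"
    by (intro sum.cong refl) (simp add: b sum_distrib_left mult_ac)
  also have "\<dots> = (\<Sum>i\<le>n. \<Sum>m=i..n. (pochhammer (e - b) i * pochhammer (e + of_nat i) (n - i)) *
      ((-1) ^ m * (-1) ^ i * of_nat (n choose m) * of_nat (m choose i) * pochhammer a m
        * pochhammer (d + of_nat m) (n - m)))"
    by (rule sum_swap_triangle)
  also have "\<dots> = (\<Sum>i\<le>n. (pochhammer (e - b) i * pochhammer (e + of_nat i) (n - i)) *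
      (of_nat (n choose i) * pochhammer a i * pochhammer (d - a) (n - i)))"
    by (intro sum.cong refl) (simp only: sum_distrib_left[symmetric] inner atMost_iff)
  also have "\<dots> = (-1) ^ n * hyp3F2 n a (e - b) e (1 + a - d - of_nat n)"
    unfolding hyp3F2_def sum_distrib_left
  proof (intro sum.cong refl)
    fix i assume "i \<in> {..n}"
    then have "i \<le> n" by simp
    have sgn: "(-1) ^ (n - i) = (-1) ^ n * ((-1) ^ i :: 'a)"
      using \<open>i \<le> n\<close> by (metis (no_types, opaque_lifting) le_add_diff_inverse2 left_minus_one_mult_self mult.commute power_add)
    have "pochhammer (1 + a - d - of_nat n + of_nat i) (n - i) = (-1) ^ n * (-1) ^ i * pochhammer (d - a) (n - i)"
      using pochhammer_reflect[of "d - a" "n - i"] \<open>i \<le> n\<close>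
      by (simp add: of_nat_diff algebra_simps sgn)
    then show "(pochhammer (e - b) i * pochhammer (e + of_nat i) (n - i)) *
      (of_nat (n choose i) * pochhammer a i * pochhammer (d - a) (n - i))
     = (-1) ^ n * ((-1) ^ i * of_nat (n choose i) * pochhammer a i * pochhammer (e - b) i
      * pochhammer (e + of_nat i) (n - i) * pochhammer (1 + a - d - of_nat n + of_nat i) (n - i))"
      by (simp add: mult_ac)
  qed
  finally show ?thesis .
qed

text \<open>The composite that carries the sum over residues to the sum in the stated coefficients.
  The parameter \<open>1 - e - n\<close> produced by the reversal is moved to the front because
  \<open>hyp3F2_transform\<close> keeps its first parameter; the three signs combine to
  \<open>(-1)^n\<close>.\<close>

lemma hyp3F2_three_step:
  fixes a :: "'a::comm_ring_1"
  shows "hyp3F2 n a b d e = (-1) ^ n * hyp3F2 n (1 - e - of_nat n) (1 + a + b - d - e - of_nat n)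
      (1 + a - e - of_nat n) (1 + b - e - of_nat n)"
proof -
  have "hyp3F2 n a b d e
      = (-1) ^ n * hyp3F2 n (1 - e - of_nat n) (1 - d - of_nat n) (1 - a - of_nat n) (1 - b - of_nat n)"
    by (subst hyp3F2_reverse) (simp add: hyp3F2_commute(1))
  also have "\<dots> = hyp3F2 n (1 - e - of_nat n) (d - b) (1 - b - of_nat n) (1 + a - e - of_nat n)"
    by (subst hyp3F2_transform) (simp add: algebra_simps)
  also have "\<dots> = (-1) ^ n * hyp3F2 n (1 - e - of_nat n) (1 + a + b - d - e - of_nat n)
      (1 + a - e - of_nat n) (1 + b - e - of_nat n)"
    by (subst hyp3F2_transform) (simp add: algebra_simps)
  finally show ?thesis .
qed

subsection \<open>Divided differences\<close>

text \<open>The left side is the divided difference of \<open>p\<close> over \<open>X\<close>. By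
  degree, \<open>p\<close> equals its Lagrange interpolant \<open>q\<close>; each basis polynomial
  \<open>L x\<close> is monic of degree \<open>card X - 1\<close>, so comparing coefficients at that
  degree gives the sum.\<close>

lemma divided_difference_polynomial:
  fixes X :: "'a::field set"
  assumes "finite X" and "degree p < card X"
  shows "(\<Sum>x\<in>X. poly p x / (\<Prod>y\<in>X - {x}. x - y)) = coeff p (card X - 1)"
proof -
  define L where "L x = (\<Prod>y\<in>X - {x}. [:- y, 1:])" for x
  define q where "q = (\<Sum>x\<in>X. smult (poly p x / (\<Prod>y\<in>X - {x}. x - y)) (L x))"
  have L_monic: "lead_coeff (L x) = 1" for x
    by (simp add: L_def lead_coeff_prod)
  have L_deg: "degree (L x) = card X - 1" if "x \<in> X" for x
    using that assms(1) by (simp add: L_def degree_prod_eq_sum_degree)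
  have L_poly: "poly (L x) z = (\<Prod>y\<in>X - {x}. z - y)" for x z
    by (simp add: L_def poly_prod)
  have "p = q"
  proof (rule poly_eqI_degree[of X])
    fix z assume z: "z \<in> X"
    have "poly q z = (\<Sum>x\<in>X. poly p x / (\<Prod>y\<in>X - {x}. x - y) * (\<Prod>y\<in>X - {x}. z - y))"
      by (simp add: q_def poly_sum L_poly)
    also have "\<dots> = (\<Sum>x\<in>X. if x = z then poly p z else 0)"
    proof (intro sum.cong refl)
      fix x assume "x \<in> X"
      show "poly p x / (\<Prod>y\<in>X - {x}. x - y) * (\<Prod>y\<in>X - {x}. z - y) = (if x = z then poly p z else 0)"
      proof (cases "x = z")
        case True
        have "(\<Prod>y\<in>X - {z}. z - y) \<noteq> 0" using assms(1) by simp
        then show ?thesis using True by simp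
      next
        case False
        then have "(\<Prod>y\<in>X - {x}. z - y) = 0"
          using z assms(1) by (auto intro!: prod_zero)
        then show ?thesis using False by simp
      qed
    qed
    also have "\<dots> = poly p z" using z assms(1) by simp
    finally show "poly p z = poly q z" by simp
  next
    have "degree q \<le> card X - 1"
      unfolding q_def
      by (rule degree_sum_le) (auto simp: assms(1) L_deg intro: order.trans[OF degree_smult_le])
    then show "degree q < card X" using assms(2) by linarith
  qed (fact assms(2))
  then have "coeff p (card X - 1) = coeff q (card X - 1)" by simp
  also have "\<dots> = (\<Sum>x\<in>X. poly p x / (\<Prod>y\<in>X - {x}. x - y) * coeff (L x) (card X - 1))"
    by (simp add: q_def coeff_sum)
  also have "\<dots> = (\<Sum>x\<in>X. poly p x / (\<Prod>y\<in>X - {x}. x - y))"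
    using L_monic L_deg by (intro sum.cong refl) (metis mult.right_neutral)
  finally show ?thesis by simp
qed

subsection \<open>Hahn weights and their moments\<close>

lemma pochhammer_minus_of_nat:
  assumes "j \<le> n"
  shows "pochhammer (- real n) j = (-1) ^ j * fact n / fact (n - j)"
proof -
  have "(fact n :: real) = fact (n - j) * pochhammer (real n - real j + 1) j"
    using pochhammer_product[of "n - j" n "1 :: real"] assms
    by (simp add: pochhammer_fact of_nat_diff add_ac)
  then show ?thesis by (simp add: pochhammer_minus)
qed

text \<open>Puts the reciprocals for all \<open>m \<le> n\<close> over one common denominator, which
  brings a sum with shifting denominators into the shape of \<open>hyp3F2\<close>.\<close>

lemma inverse_pochhammer_shift:
  fixes p :: real
  assumes "pochhammer p (q + n) \<noteq> 0" and "m \<le> n"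
  shows "1 / pochhammer (p + real m) q
    = pochhammer p m * pochhammer (p + real q + real m) (n - m) / pochhammer p (q + n)"
proof -
  have "pochhammer p (q + n) = pochhammer p m * pochhammer (p + real m) (q + (n - m))"
    using pochhammer_product[of m "q + n" p] assms(2) by simp
  also have "pochhammer (p + real m) (q + (n - m))
      = pochhammer (p + real m) q * pochhammer (p + real q + real m) (n - m)"
    by (simp add: pochhammer_product' add_ac)
  finally have *: "pochhammer p (q + n)
      = pochhammer p m * (pochhammer (p + real m) q * pochhammer (p + real q + real m) (n - m))" .
  with assms(1) have "pochhammer (p + real m) q \<noteq> 0" by auto
  with assms(1) * show ?thesis by (simp add: field_simps)
qed

lemma hahn_weight_eq:
  assumes "\<alpha> > -1" and "\<beta> > -1" and "x \<le> N"
  shows "hahn_weight N \<beta> \<alpha> x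
    = pochhammer (\<alpha> + 1) x / fact x * (pochhammer (\<beta> + 1) (N - x) / fact (N - x))"
proof -
  have Gam: "Gamma (z + 1 + real i) = pochhammer (z + 1) i * Gamma (z + 1) \<and> Gamma (z + 1) \<noteq> 0"
    if "z > -1" for z :: real and i
  proof -
    have "z + 1 > 0" using that by simp
    moreover from this have "z + 1 \<notin> \<int>\<^sub>\<le>\<^sub>0" by (auto dest: nonpos_Ints_nonpos)
    ultimately show ?thesis
      using pochhammer_Gamma[of "z + 1" i] Gamma_real_pos[of "z + 1"]
      by (metis less_irrefl nonzero_eq_divide_eq)
  qed
  have f: "Gamma (real i + 1) = fact i" for i
    by (metis Gamma_fact add.commute)
  have e: "\<alpha> + real x + 1 = \<alpha> + 1 + real x" "\<beta> + real N - real x + 1 = \<beta> + 1 + real (N - x)"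
    "real N - real x + 1 = real (N - x) + 1"
    using assms(3) by (simp_all add: of_nat_diff)
  show ?thesis
    unfolding hahn_weight_def e f using Gam[OF assms(1), of x] Gam[OF assms(2), of "N - x"] by simp
qed

text \<open>For \<open>k \<le> N - j\<close> the factor
  \<open>pochhammer (- real N + real k) j\<close> turns \<open>1 / fact (N - k)\<close> into
  \<open>(-1)^j / fact (N - j - k)\<close>. After splitting off
  \<open>pochhammer (\<beta> + 1) j\<close>, what remains is the binomial theorem for rising
  factorials of length \<open>N - j\<close>.\<close>

lemma hahn_weight_moment:
  assumes "t > -1" and "\<beta> > -1" and "j \<le> N"
  shows "(\<Sum>k = 0..N. hahn_weight N \<beta> t k * pochhammer (- real N + real k) j)
    = (-1) ^ j * pochhammer (\<beta> + 1) j * pochhammer (t + \<beta> + 2 + real j) (N - j) / fact (N - j)"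
proof -
  have zero: "pochhammer (- real N + real k) j = 0" if "k \<le> N" "N - j < k" for k
  proof -
    have "- real N + real k = - real (N - k)" using that by (simp add: of_nat_diff)
    then show ?thesis using that assms(3) by (auto simp only: pochhammer_of_nat_eq_0_iff)
  qed
  have "(\<Sum>k = 0..N. hahn_weight N \<beta> t k * pochhammer (- real N + real k) j)
      = (\<Sum>k \<le> N - j. hahn_weight N \<beta> t k * pochhammer (- real N + real k) j)"
    using zero assms(3) by (intro sum.mono_neutral_right) auto
  also have "\<dots> = (\<Sum>k \<le> N - j. (-1) ^ j * pochhammer (\<beta> + 1) j / fact (N - j) *
      (of_nat ((N - j) choose k) * pochhammer (t + 1) k * pochhammer (\<beta> + 1 + real j) (N - j - k)))"
  proof (intro sum.cong refl)
    fix k assume "k \<in> {..N - j}"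
    then have k: "k \<le> N" "k \<le> N - j" "j \<le> N - k" using assms(3) by auto
    have e: "- real N + real k = - real (N - k)" using k by (simp add: of_nat_diff)
    have b: "pochhammer (\<beta> + 1) (N - k) = pochhammer (\<beta> + 1) j * pochhammer (\<beta> + 1 + real j) (N - j - k)"
      using pochhammer_product[OF k(3), of "\<beta> + 1"] by (metis diff_commute)
    have c: "real ((N - j) choose k) = fact (N - j) / (fact k * fact (N - j - k))"
      using k by (simp add: binomial_fact)
    have d: "N - k - j = N - j - k" by simp
    have f: "pochhammer (- real (N - k)) j = (-1) ^ j * fact (N - k) / fact (N - j - k)"
      using pochhammer_minus_of_nat[OF k(3)] by (simp only: d)
    show "hahn_weight N \<beta> t k * pochhammer (- real N + real k) j
      = (-1) ^ j * pochhammer (\<beta> + 1) j / fact (N - j) *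
      (of_nat ((N - j) choose k) * pochhammer (t + 1) k * pochhammer (\<beta> + 1 + real j) (N - j - k))"
      unfolding e hahn_weight_eq[OF assms(1,2) k(1)] f b c
      by (simp add: field_simps)
  qed
  also have "\<dots> = (-1) ^ j * pochhammer (\<beta> + 1) j / fact (N - j)
      * pochhammer (t + 1 + (\<beta> + 1 + real j)) (N - j)"
    by (simp only: pochhammer_binomial_sum[of "t + 1"] sum_distrib_left)
  also have "t + 1 + (\<beta> + 1 + real j) = t + \<beta> + 2 + real j" by simp
  finally show ?thesis by simp
qed

section \<open>Hahn weights with shifted parameter\<close>

lemma hahn_weight_add:
  assumes "\<alpha> > -1" and "\<beta> > -1" and "x \<le> N"
  shows "hahn_weight N \<beta> (\<alpha> + real i) x
    = hahn_weight N \<beta> \<alpha> x * (pochhammer (\<alpha> + 1 + real x) i / pochhammer (\<alpha> + 1) i)"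
proof -
  have "pochhammer (\<alpha> + 1) i * pochhammer (\<alpha> + real i + 1) x
      = pochhammer (\<alpha> + 1) x * pochhammer (\<alpha> + 1 + real x) i"
    using pochhammer_product'[of "\<alpha> + 1" i x] pochhammer_product'[of "\<alpha> + 1" x i]
    by (simp add: add_ac)
  moreover have "pochhammer (\<alpha> + 1) i > 0" using assms(1) by (intro pochhammer_pos) simp
  ultimately have "pochhammer (\<alpha> + real i + 1) x
      = pochhammer (\<alpha> + 1) x * (pochhammer (\<alpha> + 1 + real x) i / pochhammer (\<alpha> + 1) i)"
    by (simp add: field_simps)
  moreover have "\<alpha> + real i > -1" using assms(1) by simp
  ultimately show ?thesis
    using assms by (simp add: hahn_weight_eq mult_ac)
qed

text \<open>The ratio of the two weights is a polynomial in \<open>x\<close> of degree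
  \<open>i\<close>; Chu-Vandermonde with \<open>c = - x\<close> and \<open>e = \<alpha> + 1\<close>
  writes it in the basis \<open>pochhammer (- x) l\<close> in which \<open>hahn_Q\<close> is
  given.\<close>

lemma hahn_weight_shift:
  assumes "\<alpha> > -1" and "\<beta> > -1" and "x \<le> N"
  shows "hahn_weight N \<beta> (\<alpha> + real i) x = hahn_weight N \<beta> \<alpha> x *
    (\<Sum>l\<le>i. (-1) ^ l * real (i choose l) * pochhammer (- real x) l / pochhammer (\<alpha> + 1) l)"
proof -
  have pos: "pochhammer (\<alpha> + 1) l > 0" for l
    using assms(1) by (intro pochhammer_pos) simp
  have "pochhammer (\<alpha> + 1 + real x) i
      = (\<Sum>l\<le>i. (-1) ^ l * real (i choose l) * pochhammer (- real x) l * pochhammer (\<alpha> + 1 + real l) (i - l))"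
    using pochhammer_Vandermonde[of i "- real x" "\<alpha> + 1"] by simp
  also have "\<dots> / pochhammer (\<alpha> + 1) i
      = (\<Sum>l\<le>i. (-1) ^ l * real (i choose l) * pochhammer (- real x) l / pochhammer (\<alpha> + 1) l)"
    unfolding sum_divide_distrib
  proof (intro sum.cong refl)
    fix l assume "l \<in> {..i}"
    then have *: "pochhammer (\<alpha> + 1) i = pochhammer (\<alpha> + 1) l * pochhammer (\<alpha> + 1 + real l) (i - l)"
      using pochhammer_product by simp
    with pos[of i] have "pochhammer (\<alpha> + 1 + real l) (i - l) \<noteq> 0" by auto
    then show "(-1) ^ l * real (i choose l) * pochhammer (- real x) l * pochhammer (\<alpha> + 1 + real l) (i - l)
      / pochhammer (\<alpha> + 1) i
      = (-1) ^ l * real (i choose l) * pochhammer (- real x) l / pochhammer (\<alpha> + 1) l"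
      unfolding * by simp
  qed
  finally show ?thesis
    unfolding hahn_weight_add[OF assms] by (simp only:)
qed

subsection \<open>The coefficients as residues\<close>

text \<open>
  The residue of \<open>1 / ((t + \<beta> + n + n')\<^bsub>N+2-n-n'\<^esub> \<Prod>\<^sub>y (t - y))\<close> at \<open>t = \<alpha> + i\<close>, where \<open>y\<close> runs over
  \<open>\<alpha>, \<dots>, \<alpha> + n - 1, \<alpha>', \<dots>, \<alpha>' + n' - 1\<close>.
\<close>

definition hahn_residue :: "nat \<Rightarrow> real \<Rightarrow> real \<Rightarrow> real \<Rightarrow> nat \<Rightarrow> nat \<Rightarrow> nat \<Rightarrow> real" where
  "hahn_residue N \<beta> \<alpha> \<alpha>' n n' i = (-1) ^ (n - 1 - i) /
     (fact i * fact (n - 1 - i) * pochhammer (\<alpha> + \<beta> + real n + real n' + real i) (N + 2 - n - n')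
       * pochhammer (\<alpha> - \<alpha>' - real n' + 1 + real i) n')"

text \<open>The first two factors form the product of \<open>y - t\<close> over all shifted
  parameters \<open>y\<close>, at the pole \<open>t = - \<beta> - n - n'\<close>. The rest cancels,
  up to sign, the constant of the moment \<open>j = n + n' - 1\<close>, which is to become
  1.\<close>

definition hahn_norm :: "nat \<Rightarrow> real \<Rightarrow> real \<Rightarrow> real \<Rightarrow> nat \<Rightarrow> nat \<Rightarrow> real" where
  "hahn_norm N \<beta> \<alpha> \<alpha>' n n' =
     pochhammer (\<alpha> + \<beta> + real n + real n') n * pochhammer (\<alpha>' + \<beta> + real n + real n') n'
       * fact (N + 1 - n - n') / pochhammer (\<beta> + 1) (n + n' - 1)"

text \<open>When the weights with parameters \<open>\<alpha> + i\<close> are combined with the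
  residues, \<open>hahn_weight_shift\<close> makes this sum the coefficient of
  \<open>pochhammer (- x) l\<close>, up to the factor
  \<open>(-1)^l / pochhammer (\<alpha> + 1) l\<close>. With \<open>i = l + m\<close> both reciprocal
  symbols get common denominators and a terminating series appears.\<close>

lemma hahn_residue_binomial_sum:
  assumes "\<alpha> + \<beta> > -2" and "2 \<le> n + n'" and "n + n' \<le> N + 1" and "l < n"
    and "pochhammer (\<alpha> - \<alpha>' - real n' + 1 + real l) (n' + (n - 1 - l)) \<noteq> 0"
  shows "(\<Sum>i = l..<n. real (i choose l) * hahn_residue N \<beta> \<alpha> \<alpha>' n n' i)
    = (-1) ^ (n - 1 - l) / (fact l * fact (n - 1 - l)
        * pochhammer (\<alpha> + \<beta> + real n + real n' + real l) (N + 2 - n - n' + (n - 1 - l))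
        * pochhammer (\<alpha> - \<alpha>' - real n' + 1 + real l) (n' + (n - 1 - l)))
      * hyp3F2 (n - 1 - l) (\<alpha> + \<beta> + real n + real n' + real l) (\<alpha> - \<alpha>' - real n' + 1 + real l)
          (\<alpha> + \<beta> + real N + 2 + real l) (\<alpha> - \<alpha>' + 1 + real l)"
proof -
  define \<nu> where "\<nu> = n - 1 - l"
  define q where "q = N + 2 - n - n'"
  define p where "p = \<alpha> + \<beta> + real n + real n' + real l"
  define s where "s = \<alpha> - \<alpha>' - real n' + 1 + real l"
  have "p > 0" using assms(1,2) by (simp add: p_def)
  then have p0: "pochhammer p (q + \<nu>) \<noteq> 0" by (metis less_irrefl pochhammer_pos)
  have s0: "pochhammer s (n' + \<nu>) \<noteq> 0" using assms(5) by (simp add: s_def \<nu>_def)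
  have n: "n = Suc (l + \<nu>)" using assms(4) by (simp add: \<nu>_def)
  have pq: "\<alpha> + \<beta> + real N + 2 + real l = p + real q"
    using assms(3) by (simp add: p_def q_def of_nat_diff)
  have sr: "\<alpha> - \<alpha>' + 1 + real l = s + real n'" by (simp add: s_def)
  have "(\<Sum>i = l..<n. real (i choose l) * hahn_residue N \<beta> \<alpha> \<alpha>' n n' i)
      = (\<Sum>m\<le>\<nu>. real ((l + m) choose l) * hahn_residue N \<beta> \<alpha> \<alpha>' n n' (l + m))"
    by (rule sum.reindex_bij_witness[of _ "\<lambda>m. l + m" "\<lambda>i. i - l"]) (auto simp: n)
  also have "\<dots> = (\<Sum>m\<le>\<nu>. (-1) ^ \<nu> / (fact l * fact \<nu> * pochhammer p (q + \<nu>) * pochhammer s (n' + \<nu>)) *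
      ((-1) ^ m * real (\<nu> choose m) * pochhammer p m * pochhammer s m
        * pochhammer (p + real q + real m) (\<nu> - m) * pochhammer (s + real n' + real m) (\<nu> - m)))"
  proof (intro sum.cong refl)
    fix m assume "m \<in> {..\<nu>}"
    then have m: "m \<le> \<nu>" by simp
    have c: "real ((l + m) choose l) = fact (l + m) / (fact l * fact m)"
      by (simp add: binomial_fact)
    have d: "real (\<nu> choose m) = fact \<nu> / (fact m * fact (\<nu> - m))"
      using m by (simp add: binomial_fact)
    have sgn: "(-1) ^ (\<nu> - m) = (-1) ^ \<nu> * ((-1) ^ m :: real)"
      using m by (metis (no_types, opaque_lifting) le_add_diff_inverse2 left_minus_one_mult_self mult.commute power_add)
    have "real ((l + m) choose l) * hahn_residue N \<beta> \<alpha> \<alpha>' n n' (l + m)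
      = fact (l + m) / (fact l * fact m) * ((-1) ^ (\<nu> - m) / (fact (l + m) * fact (\<nu> - m)))
         * (1 / pochhammer (p + real m) q) * (1 / pochhammer (s + real m) n')"
      by (simp add: hahn_residue_def c n p_def s_def q_def add_ac)
    also have "\<dots> = (-1) ^ (\<nu> - m) / (fact l * fact m * fact (\<nu> - m))
         * (1 / pochhammer (p + real m) q) * (1 / pochhammer (s + real m) n')"
      by simp
    also have "\<dots> = (-1) ^ \<nu> / (fact l * fact \<nu> * pochhammer p (q + \<nu>) * pochhammer s (n' + \<nu>)) *
      ((-1) ^ m * real (\<nu> choose m) * pochhammer p m * pochhammer s m
        * pochhammer (p + real q + real m) (\<nu> - m) * pochhammer (s + real n' + real m) (\<nu> - m))"
      unfolding inverse_pochhammer_shift[OF p0 m] inverse_pochhammer_shift[OF s0 m] sgn d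
      by (simp add: mult_ac)
    finally show "real ((l + m) choose l) * hahn_residue N \<beta> \<alpha> \<alpha>' n n' (l + m)
      = (-1) ^ \<nu> / (fact l * fact \<nu> * pochhammer p (q + \<nu>) * pochhammer s (n' + \<nu>)) *
      ((-1) ^ m * real (\<nu> choose m) * pochhammer p m * pochhammer s m
        * pochhammer (p + real q + real m) (\<nu> - m) * pochhammer (s + real n' + real m) (\<nu> - m))" .
  qed
  also have "\<dots> = (-1) ^ \<nu> / (fact l * fact \<nu> * pochhammer p (q + \<nu>) * pochhammer s (n' + \<nu>))
      * hyp3F2 \<nu> p s (p + real q) (s + real n')"
    by (simp only: hyp3F2_def sum_distrib_left)
  finally show ?thesis
    by (simp only: pq sr flip: p_def s_def \<nu>_def q_def)
qed

text \<open>Since \<open>- real n + 1 + real l = - real \<nu>\<close>, the first symbol supplies the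
  signed binomial coefficients and cancels \<open>fact m\<close>, while the two denominators are
  extended to the full index \<open>n - 1\<close>.\<close>

lemma hahn_C_sum:
  assumes "2 \<le> n + n'" and "1 \<le> n'" and "l < n" and "A' > -2"
  shows "(\<Sum>m = 0..n - 1 - l.
        pochhammer (- real n + 1) (l + m) * pochhammer (- real N) (l + m) * pochhammer c m /
        (fact m * pochhammer (- real n - real n' + 2) (l + m) * pochhammer (A' + real n' + 1) (l + m)))
    = pochhammer (- real n + 1) l * pochhammer (- real N) l
      / (pochhammer (- real n - real n' + 2) (n - 1) * pochhammer (A' + real n' + 1) (n - 1))
      * hyp3F2 (n - 1 - l) c (- real N + real l) (- real n - real n' + 2 + real l) (A' + real n' + 1 + real l)"
proof -
  define \<nu> where "\<nu> = n - 1 - l"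
  define u where "u = - real n - real n' + 2"
  define v where "v = A' + real n' + 1"
  have n: "n - 1 = l + \<nu>" using assms(3) by (simp add: \<nu>_def)
  have u: "u = - real (n + n' - 2)" using assms(1) by (simp add: u_def of_nat_diff)
  \<comment> \<open>\<open>u\<close> is a nonpositive integer, and the symbol is nonzero because
    \<open>n - 1 \<le> n + n' - 2\<close>, that is, because \<open>n' \<ge> 1\<close>.\<close>
  have u0: "pochhammer u (l + \<nu>) \<noteq> 0"
    unfolding u pochhammer_of_nat_eq_0_iff using assms(1,2) n by linarith
  have "v > 0" using assms(2,4) by (simp add: v_def)
  then have v0: "pochhammer v (l + \<nu>) \<noteq> 0" by (metis less_irrefl pochhammer_pos)
  have split: "pochhammer z (l + \<nu>) = pochhammer z (l + m) * pochhammer (z + real l + real m) (\<nu> - m)"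
    if "m \<le> \<nu>" for z and m
    using pochhammer_product[of "l + m" "l + \<nu>" z] that by (simp add: add_ac)
  have inv: "1 / pochhammer z (l + m) = pochhammer (z + real l + real m) (\<nu> - m) / pochhammer z (l + \<nu>)"
    if "m \<le> \<nu>" "pochhammer z (l + \<nu>) \<noteq> 0" for z and m
    using split[OF that(1), of z] that(2) by (auto simp: field_simps)
  have n1: "- real n + 1 + real l = - real \<nu>"
    using assms(3) by (simp add: \<nu>_def of_nat_diff)
  have "(\<Sum>m = 0..\<nu>.
        pochhammer (- real n + 1) (l + m) * pochhammer (- real N) (l + m) * pochhammer c m /
        (fact m * pochhammer u (l + m) * pochhammer v (l + m)))
    = (\<Sum>m\<le>\<nu>. pochhammer (- real n + 1) l * pochhammer (- real N) l
          / (pochhammer u (l + \<nu>) * pochhammer v (l + \<nu>)) *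
       ((-1) ^ m * real (\<nu> choose m) * pochhammer c m * pochhammer (- real N + real l) m
         * pochhammer (u + real l + real m) (\<nu> - m) * pochhammer (v + real l + real m) (\<nu> - m)))"
    unfolding atMost_atLeast0
  proof (intro sum.cong refl)
    fix m assume "m \<in> {0..\<nu>}"
    then have m: "m \<le> \<nu>" by simp
    have a: "pochhammer (- real n + 1) (l + m) = pochhammer (- real n + 1) l * ((-1) ^ m * real (\<nu> choose m) * fact m)"
      using m by (simp only: pochhammer_product' n1) (simp add: pochhammer_minus_of_nat binomial_fact)
    have b: "pochhammer (- real N) (l + m) = pochhammer (- real N) l * pochhammer (- real N + real l) m"
      by (rule pochhammer_product')
    have "pochhammer (- real n + 1) (l + m) * pochhammer (- real N) (l + m) * pochhammer c m /
        (fact m * pochhammer u (l + m) * pochhammer v (l + m))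
      = pochhammer (- real n + 1) (l + m) / fact m * pochhammer (- real N) (l + m) * pochhammer c m *
         (1 / pochhammer u (l + m)) * (1 / pochhammer v (l + m))"
      by simp
    also have "\<dots> = pochhammer (- real n + 1) l * pochhammer (- real N) l
          / (pochhammer u (l + \<nu>) * pochhammer v (l + \<nu>)) *
       ((-1) ^ m * real (\<nu> choose m) * pochhammer c m * pochhammer (- real N + real l) m
         * pochhammer (u + real l + real m) (\<nu> - m) * pochhammer (v + real l + real m) (\<nu> - m))"
      unfolding inv[OF m u0] inv[OF m v0] a b by (simp add: mult_ac)
    finally show "pochhammer (- real n + 1) (l + m) * pochhammer (- real N) (l + m) * pochhammer c m /
        (fact m * pochhammer u (l + m) * pochhammer v (l + m))
      = pochhammer (- real n + 1) l * pochhammer (- real N) l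
          / (pochhammer u (l + \<nu>) * pochhammer v (l + \<nu>)) *
       ((-1) ^ m * real (\<nu> choose m) * pochhammer c m * pochhammer (- real N + real l) m
         * pochhammer (u + real l + real m) (\<nu> - m) * pochhammer (v + real l + real m) (\<nu> - m))" .
  qed
  also have "\<dots> = pochhammer (- real n + 1) l * pochhammer (- real N) l
          / (pochhammer u (l + \<nu>) * pochhammer v (l + \<nu>))
      * hyp3F2 \<nu> c (- real N + real l) (u + real l) (v + real l)"
    by (simp only: hyp3F2_def sum_distrib_left)
  finally show ?thesis
    by (simp only: n diff_add_inverse flip: u_def v_def)
qed

text \<open>Both sides reduce to the same \<open>hyp3F2\<close> value \<open>W\<close>: the left by
  \<open>hahn_C_sum\<close>, the right by \<open>hahn_residue_binomial_sum\<close> followed by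
  \<open>hyp3F2_three_step\<close>. It remains to match the prefactors, by splitting Pochhammer
  symbols at different places.\<close>

lemma hahn_C_eq:
  assumes "\<alpha> > -1" "\<alpha>' > -1" "\<beta> > -1" and "1 \<le> n" "1 \<le> n'" and "n + n' \<le> N + 1" and "l < n"
    and d0: "pochhammer (\<alpha> - \<alpha>' - real n' + 1) (n + n' - 1) \<noteq> 0"
  shows "hahn_C N \<beta> \<alpha> \<alpha>' n n' l = hahn_norm N \<beta> \<alpha> \<alpha>' n n' * ((-1) ^ l / pochhammer (\<alpha> + 1) l) *
    (\<Sum>i = l..<n. real (i choose l) * hahn_residue N \<beta> \<alpha> \<alpha>' n n' i)"
proof -
  define \<nu> where "\<nu> = n - 1 - l"
  define q where "q = N + 2 - n - n'"
  define p where "p = \<alpha> + \<beta> + real n + real n' + real l"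
  define s where "s = \<alpha> - \<alpha>' - real n' + 1 + real l"
  define a0 where "a0 = \<alpha> + \<beta> + real n + real n'"
  define s0 where "s0 = \<alpha> - \<alpha>' - real n' + 1"
  define W where "W = hyp3F2 \<nu> (\<alpha>' - \<alpha> - real n + 1) (- real N + real l)
      (- real n - real n' + 2 + real l) (\<alpha>' + \<beta> + real n' + 1 + real l)"
  have n: "n - 1 = l + \<nu>" "n = Suc (l + \<nu>)" using assms(7) by (auto simp: \<nu>_def)
  have W: "hyp3F2 \<nu> p s (\<alpha> + \<beta> + real N + 2 + real l) (\<alpha> - \<alpha>' + 1 + real l) = (-1) ^ \<nu> * W"
    unfolding W_def
    by (subst hyp3F2_three_step, subst hyp3F2_commute(2)) (simp add: p_def s_def n(2) algebra_simps)
  \<comment> \<open>Both sides are \<open>pochhammer a0 (N + 1 - n')\<close>, split at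
    \<open>l\<close> and at \<open>n\<close>.\<close>
  have E1: "pochhammer a0 l * pochhammer p (q + \<nu>) = pochhammer a0 n * pochhammer (a0 + real n) (N + 1 - n - n')"
  proof -
    have "l + (q + \<nu>) = n + (N + 1 - n - n')" using assms(6) by (simp add: q_def n(2))
    then show ?thesis
      using pochhammer_product'[of a0 l "q + \<nu>"] pochhammer_product'[of a0 n "N + 1 - n - n'"]
      by (simp only: p_def a0_def)
  qed
  have E2: "pochhammer s0 (n + n' - 1) = pochhammer s0 l * pochhammer s (n' + \<nu>)"
  proof -
    have "n + n' - 1 = l + (n' + \<nu>)" by (simp add: n(2))
    then show ?thesis by (simp only: pochhammer_product' s_def s0_def)
  qed
  have E3: "pochhammer (\<alpha>' + \<beta> + real n' + 1) (n + n' - 1)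
      = pochhammer (\<alpha>' + \<beta> + real n' + 1) (n - 1) * pochhammer (\<alpha>' + \<beta> + real n + real n') n'"
    using pochhammer_product'[of "\<alpha>' + \<beta> + real n' + 1" "n - 1" n'] assms(4)
    by (simp add: of_nat_diff add_ac)
  have E4: "pochhammer (- real n + 1) l = (-1) ^ l * fact (n - 1) / fact \<nu>"
    using pochhammer_minus_of_nat[of l "n - 1"] by (simp add: n(2))
  have E5: "pochhammer (- real n - real n' + 2) (n - 1) = (-1) ^ (n - 1) * fact (n + n' - 2) / fact (n' - 1)"
  proof -
    have "- real n - real n' + 2 = - real (n + n' - 2)" "n + n' - 2 - (n - 1) = n' - 1" "n - 1 \<le> n + n' - 2"
      using assms(4,5) by (auto simp: of_nat_diff)
    then show ?thesis using pochhammer_minus_of_nat[of "n - 1" "n + n' - 2"] by simp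
  qed
  have nz: "pochhammer s (n' + \<nu>) \<noteq> 0" "pochhammer s0 l \<noteq> 0"
    using d0 E2 by (auto simp: s0_def)
  have "a0 > 0" using assms by (simp add: a0_def)
  then have pp: "pochhammer a0 i > 0" "pochhammer p i > 0" "pochhammer (a0 + real n) i > 0" for i
    by (auto intro!: pochhammer_pos simp: p_def a0_def)
  have vp: "pochhammer (\<alpha>' + \<beta> + real n' + 1) i > 0" "pochhammer (\<alpha> + 1) i > 0" "pochhammer (\<beta> + 1) i > 0" for i
    using assms by (auto intro!: pochhammer_pos)
  have N0: "pochhammer (- real N) l \<noteq> 0"
    unfolding pochhammer_of_nat_eq_0_iff using assms by linarith
  have G: "hahn_norm N \<beta> \<alpha> \<alpha>' n n' = pochhammer a0 n * pochhammer (\<alpha>' + \<beta> + real n + real n') n'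
       * fact (N + 1 - n - n') / pochhammer (\<beta> + 1) (n + n' - 1)"
    by (simp add: hahn_norm_def a0_def)
  have C: "hahn_C N \<beta> \<alpha> \<alpha>' n n' l =
     (-1) ^ (n - 1) * fact (N + 1 - n - n') * fact (n + n' - 2) /
       (fact (n - 1) * fact (n' - 1) * pochhammer (\<beta> + 1) (n + n' - 1) * pochhammer (a0 + real n) (N + 1 - n - n')) *
     (pochhammer (\<alpha>' + \<beta> + real n' + 1) (n - 1) * pochhammer (\<alpha>' + \<beta> + real n + real n') n'
        / (pochhammer s0 l * pochhammer s (n' + \<nu>))) *
     (pochhammer a0 l * pochhammer s0 l / (fact l * pochhammer (\<alpha> + 1) l * pochhammer (- real N) l)) *
     ((-1) ^ l * fact (n - 1) / fact \<nu> * pochhammer (- real N) l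
      / ((-1) ^ (n - 1) * fact (n + n' - 2) / fact (n' - 1) * pochhammer (\<alpha>' + \<beta> + real n' + 1) (n - 1)) * W)"
    unfolding hahn_C_def hahn_K_def
    using hahn_C_sum[of n n' l "\<alpha>' + \<beta>" N "\<alpha>' - \<alpha> - real n + 1"] assms
    by (simp only: E3 E2[unfolded s0_def] E4 E5 W_def \<nu>_def a0_def s0_def)
  have R: "(\<Sum>i = l..<n. real (i choose l) * hahn_residue N \<beta> \<alpha> \<alpha>' n n' i)
    = (-1) ^ \<nu> / (fact l * fact \<nu> * pochhammer p (q + \<nu>) * pochhammer s (n' + \<nu>)) * ((-1) ^ \<nu> * W)"
  proof -
    have "\<alpha> + \<beta> > -2" "2 \<le> n + n'" using assms by auto
    from hahn_residue_binomial_sum[OF this assms(6,7), of \<alpha>'] nz(1)[unfolded s_def \<nu>_def]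
    show ?thesis
      unfolding W[symmetric] unfolding p_def s_def q_def \<nu>_def .
  qed
  \<comment> \<open>The comparison of prefactors, with one variable for each sign, factorial and
    Pochhammer symbol. \<open>S1\<close>, \<open>S2\<close>, \<open>S3\<close> are the powers of -1
    with exponents \<open>n - 1\<close>, \<open>l\<close>, \<open>\<nu>\<close>, and
    \<open>P1 * P4 = P2 * P3\<close> is \<open>E1\<close>.\<close>
  have alg: "S1 * F1 * F2 / (F3 * F4 * B * P3) * (V1 * V2 / (s1 * s2)) * (P1 * s1 / (L * a1 * X))
      * (S2 * F3 / F5 * X / (S1 * F2 / F4 * V1) * W)
    = P2 * V2 * F1 / B * (S2 / a1) * (S3 / (L * F5 * P4 * s2) * (S3 * W))"
    if "P1 * P4 = P2 * P3" "S1 \<noteq> 0" "F2 \<noteq> 0" "F3 \<noteq> 0" "F4 \<noteq> 0" "P3 \<noteq> 0" "P4 \<noteq> 0" "V1 \<noteq> 0" "s1 \<noteq> 0" "X \<noteq> 0" "S3 * S3 = 1"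
    for S1 S2 S3 F1 F2 F3 F4 F5 B P1 P2 P3 P4 V1 V2 s1 s2 L a1 X :: real
  proof -
    have "P1 / P3 = P2 / P4" using that by (simp add: field_simps)
    have "S1 * F1 * F2 / (F3 * F4 * B * P3) * (V1 * V2 / (s1 * s2)) * (P1 * s1 / (L * a1 * X))
      * (S2 * F3 / F5 * X / (S1 * F2 / F4 * V1) * W)
      = F1 * V2 * S2 * W / (B * s2 * L * a1 * F5) * (P1 / P3)"
      using that by (simp add: mult_ac)
    also have "\<dots> = F1 * V2 * S2 * W / (B * s2 * L * a1 * F5) * (P2 / P4) * (S3 * S3)"
      using \<open>P1 / P3 = P2 / P4\<close> that(11) by simp
    finally show ?thesis by (simp add: mult_ac)
  qed
  show ?thesis
    unfolding C R G
    using E1 pp vp nz N0 by (intro alg) (auto simp: less_imp_neq[THEN not_sym] simp flip: power_mult_distrib)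
qed

text \<open>For \<open>n' = 0\<close> the residue no longer contains \<alpha>', which may thus be
  replaced by \<alpha>. Then \<open>1 + real l\<close> is both a numerator and a denominator
  parameter, it cancels, and the remaining series is summed by Chu-Vandermonde.\<close>

lemma hahn_C0_eq:
  assumes "\<alpha> > -1" "\<beta> > -1" and "2 \<le> n" "n \<le> N + 1" and "l < n"
  shows "hahn_C0 N \<beta> \<alpha> n l = hahn_norm N \<beta> \<alpha> \<alpha>' n 0 * ((-1) ^ l / pochhammer (\<alpha> + 1) l) *
    (\<Sum>i = l..<n. real (i choose l) * hahn_residue N \<beta> \<alpha> \<alpha>' n 0 i)"
proof -
  define \<nu> where "\<nu> = n - 1 - l"
  define q where "q = N + 2 - n"
  define a0 where "a0 = \<alpha> + \<beta> + real n"
  define p where "p = \<alpha> + \<beta> + real n + real l"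
  have n: "n - 1 = l + \<nu>" "n = Suc (l + \<nu>)" using assms(5) by (auto simp: \<nu>_def)
  have nu: "\<alpha> + \<beta> + real N + 2 + real l = p + real q"
    using assms(4) by (simp add: p_def q_def of_nat_diff)
  have CV: "(\<Sum>m\<le>\<nu>. (-1) ^ m * real (\<nu> choose m) * pochhammer p m * pochhammer (p + real q + real m) (\<nu> - m))
      = pochhammer (real q) \<nu>"
    using pochhammer_Vandermonde[of \<nu> p "p + real q"] by simp
  have q: "pochhammer (real q) \<nu> = fact (N - l) / fact (N + 1 - n)"
  proof -
    have "real q = 1 + real (N + 1 - n)" "N - l = (N + 1 - n) + \<nu>"
      using assms(4) by (auto simp: q_def n(2) of_nat_diff)
    then have "(fact (N - l) :: real) = fact (N + 1 - n) * pochhammer (real q) \<nu>"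
      by (simp only: pochhammer_fact pochhammer_product')
    then show ?thesis by simp
  qed
  have "a0 > 0" using assms by (simp add: a0_def)
  then have pp: "pochhammer a0 i > 0" "pochhammer p i > 0" "pochhammer (a0 + real n) i > 0" for i
    by (auto intro!: pochhammer_pos simp: p_def a0_def)
  have vp: "pochhammer (\<alpha> + 1) i > 0" "pochhammer (\<beta> + 1) i > 0" for i
    using assms by (auto intro!: pochhammer_pos)
  have E1: "pochhammer a0 l * pochhammer p (q + \<nu>) = pochhammer a0 n * pochhammer (a0 + real n) (N + 1 - n)"
  proof -
    have "l + (q + \<nu>) = n + (N + 1 - n)" using assms(4) by (simp add: q_def n(2))
    then show ?thesis
      using pochhammer_product'[of a0 l "q + \<nu>"] pochhammer_product'[of a0 n "N + 1 - n"]
      by (simp only: p_def a0_def)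
  qed
  have E4: "pochhammer (- real n + 1) l = (-1) ^ l * fact (n - 1) / fact \<nu>"
    using pochhammer_minus_of_nat[of l "n - 1"] by (simp add: n(2))
  have E5: "pochhammer (- real N) l = (-1) ^ l * fact N / fact (N - l)"
    using assms by (intro pochhammer_minus_of_nat) simp
  have sgn: "(-1) ^ (n - 1) = (-1) ^ l * ((-1) ^ \<nu> :: real)" by (simp add: n power_add)
  have R: "(\<Sum>i = l..<n. real (i choose l) * hahn_residue N \<beta> \<alpha> \<alpha>' n 0 i)
    = (-1) ^ \<nu> / (fact l * fact \<nu> * pochhammer p (q + \<nu>)) * (fact (N - l) / fact (N + 1 - n))"
  proof -
    have "hahn_residue N \<beta> \<alpha> \<alpha>' n 0 i = hahn_residue N \<beta> \<alpha> \<alpha> n 0 i" for i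
      by (simp add: hahn_residue_def)
    moreover have "pochhammer (1 + real l) \<nu> \<noteq> 0"
      by (metis less_irrefl of_nat_0_le_iff add_pos_nonneg zero_less_one pochhammer_pos)
    moreover have "hyp3F2 \<nu> p (1 + real l) (p + real q) (1 + real l)
        = pochhammer (1 + real l) \<nu> * pochhammer (real q) \<nu>"
      unfolding CV[symmetric] hyp3F2_def sum_distrib_left
    proof (intro sum.cong refl)
      fix m assume "m \<in> {..\<nu>}"
      then have "pochhammer (1 + real l) \<nu> = pochhammer (1 + real l) m * pochhammer (1 + real l + real m) (\<nu> - m)"
        using pochhammer_product by simp
      then show "(- 1) ^ m * real (\<nu> choose m) * pochhammer p m * pochhammer (1 + real l) m
          * pochhammer (p + real q + real m) (\<nu> - m) * pochhammer (1 + real l + real m) (\<nu> - m)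
        = pochhammer (1 + real l) \<nu> * ((- 1) ^ m * real (\<nu> choose m) * pochhammer p m
          * pochhammer (p + real q + real m) (\<nu> - m))"
        by (simp only: mult_ac)
    qed
    moreover have e: "\<alpha> - \<alpha> - real 0 + 1 + real l = 1 + real l" "\<alpha> + \<beta> + real n + real 0 + real l = p"
        "\<alpha> - \<alpha> + 1 + real l = 1 + real l" "N + 2 - n - 0 = q" "0 + \<nu> = \<nu>"
      by (simp_all add: p_def q_def)
    moreover have "\<alpha> + \<beta> > -2" "2 \<le> n + 0" "n + 0 \<le> N + 1" using assms by auto
    ultimately show ?thesis
      using hahn_residue_binomial_sum[of \<alpha> \<beta> n 0 N l \<alpha>, folded \<nu>_def, unfolded e nu] assms(5)
      by (simp add: q)
  qed
  have C: "hahn_C0 N \<beta> \<alpha> n l = (-1) ^ (n - 1) * fact N /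
       (fact (n - 1) * pochhammer (\<beta> + 1) (n - 1) * pochhammer (a0 + real n) (N + 1 - n)) *
     (((-1) ^ l * fact (n - 1) / fact \<nu>) * pochhammer a0 l /
       (fact l * pochhammer (\<alpha> + 1) l * ((-1) ^ l * fact N / fact (N - l))))"
  proof -
    have e: "\<alpha> + \<beta> + 2 * real n = a0 + real n" by (simp add: a0_def)
    show ?thesis unfolding hahn_C0_def E4 E5 e a0_def[symmetric] ..
  qed
  have G: "hahn_norm N \<beta> \<alpha> \<alpha>' n 0 = pochhammer a0 n * fact (N + 1 - n) / pochhammer (\<beta> + 1) (n - 1)"
    by (simp add: hahn_norm_def a0_def)
  have alg: "S1 * S2 * F1 / (F2 * B * P3) * ((S1 * F2 / F3) * P1 / (L * a1 * (S1 * F1 / F4)))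
     = P2 * F5 / B * (S1 / a1) * (S2 / (L * F3 * P4) * (F4 / F5))"
    if "P1 * P4 = P2 * P3" "S1 \<noteq> 0" "F1 \<noteq> 0" "F2 \<noteq> 0" "F5 \<noteq> 0" "P3 \<noteq> 0" "P4 \<noteq> 0"
    for S1 S2 F1 F2 F3 F4 F5 B P1 P2 P3 P4 L a1 :: real
  proof -
    have e: "P1 / P3 = P2 / P4" using that by (simp add: field_simps)
    have "S1 * S2 * F1 / (F2 * B * P3) * ((S1 * F2 / F3) * P1 / (L * a1 * (S1 * F1 / F4)))
      = S1 * S2 * F4 / (B * F3 * L * a1) * (P1 / P3)"
      using that by (simp add: mult_ac)
    then show ?thesis unfolding e using that by (simp add: mult_ac)
  qed
  show ?thesis
    unfolding C R G sgn
    using E1 pp vp by (intro alg) (auto simp: less_imp_neq[THEN not_sym])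
qed

text \<open>Inserting the coefficients gives a sum over \<open>l \<le> i < n\<close>; summing over
  \<open>l\<close> first collects, for each \<open>i\<close>, exactly the expansion of
  \<open>hahn_weight_shift\<close>. The condition \<open>d0\<close> is asked for only when both
  indices are positive, the case of \<open>hahn_C_eq\<close>.\<close>

lemma hahn_Q_times_weight:
  assumes "\<alpha> > -1" "\<alpha>' > -1" "\<beta> > -1" and "2 \<le> n + n'" and "n + n' \<le> N + 1" and "k \<le> N"
    and d0: "1 \<le> n \<Longrightarrow> 1 \<le> n' \<Longrightarrow> pochhammer (\<alpha> - \<alpha>' - real n' + 1) (n + n' - 1) \<noteq> 0"
  shows "hahn_Q N \<beta> \<alpha> \<alpha>' n n' (real k) * hahn_weight N \<beta> \<alpha> k
    = hahn_norm N \<beta> \<alpha> \<alpha>' n n' * (\<Sum>i<n. hahn_residue N \<beta> \<alpha> \<alpha>' n n' i * hahn_weight N \<beta> (\<alpha> + real i) k)"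
proof (cases n)
  case 0
  then show ?thesis by (simp add: hahn_Q_def)
next
  case (Suc n0)
  let ?G = "hahn_norm N \<beta> \<alpha> \<alpha>' n n'" and ?r = "hahn_residue N \<beta> \<alpha> \<alpha>' n n'"
  let ?e = "\<lambda>i l. (-1) ^ l * real (i choose l) * pochhammer (- real k) l / pochhammer (\<alpha> + 1) l"
  have c: "(if n' = 0 then hahn_C0 N \<beta> \<alpha> n l else hahn_C N \<beta> \<alpha> \<alpha>' n n' l)
      = ?G * ((-1) ^ l / pochhammer (\<alpha> + 1) l) * (\<Sum>i = l..<n. real (i choose l) * ?r i)" if "l < n" for l
    using hahn_C0_eq[of \<alpha> \<beta> n N l \<alpha>'] hahn_C_eq[of \<alpha> \<alpha>' \<beta> n n' N l] assms that by auto
  have "hahn_Q N \<beta> \<alpha> \<alpha>' n n' (real k) = (\<Sum>l<n. \<Sum>i = l..<n. ?G * ?r i * ?e i l)"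
    unfolding hahn_Q_def by (intro sum.cong refl) (simp add: c sum_distrib_left sum_distrib_right sum_divide_distrib mult_ac)
  also have "\<dots> = (\<Sum>i<n. \<Sum>l\<le>i. ?G * ?r i * ?e i l)"
    using sum_swap_triangle[of "\<lambda>i l. ?G * ?r i * ?e i l" n0]
    by (simp only: Suc lessThan_Suc_atMost atLeastLessThanSuc_atLeastAtMost)
  finally have Q: "hahn_Q N \<beta> \<alpha> \<alpha>' n n' (real k) = (\<Sum>i<n. \<Sum>l\<le>i. ?G * ?r i * ?e i l)" .
  show ?thesis
    unfolding Q hahn_weight_shift[OF assms(1,3,6)]
    by (simp only: sum_distrib_left sum_distrib_right mult_ac)
qed

section \<open>Node differences and partial fractions\<close>

lemma prod_diff_index:
  assumes "i < n"
  shows "(\<Prod>j\<in>{..<n} - {i}. real i - real j) = (-1) ^ (n - 1 - i) * fact i * fact (n - 1 - i)"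
  using Suc_leI[OF assms]
proof (induction n rule: nat_induct_at_least)
  case base
  have "{..<Suc i} - {i} = {..<i}" by auto
  moreover have "(\<Prod>j<i. real i - real j) = fact i"
    by (simp add: fact_prod_rev of_nat_diff atLeast0LessThan)
  ultimately show ?case by simp
next
  case (Suc n)
  then have "{..<Suc n} - {i} = insert n ({..<n} - {i})" "Suc n - 1 - i = Suc (n - 1 - i)"
      "real i - real n = - real (Suc (n - 1 - i))"
    by (auto simp: of_nat_diff)
  then show ?case using Suc.IH by (simp del: of_nat_Suc add: mult_ac)
qed

lemma prod_diff_pochhammer:
  fixes b :: "'a::comm_ring_1"
  shows "(\<Prod>j<n. b - of_nat j) = pochhammer (b - of_nat n + 1) n"
proof -
  have "pochhammer (b - of_nat n + 1) n = (-1) ^ n * (\<Prod>j<n. - b + of_nat j)"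
    unfolding pochhammer_minus' unfolding pochhammer_prod atLeast0LessThan ..
  also have "\<dots> = (\<Prod>j<n. (-1) * (- b + of_nat j))"
    by (simp only: prod.distrib prod_constant card_lessThan)
  also have "\<dots> = (\<Prod>j<n. b - of_nat j)" by (intro prod.cong) auto
  finally show ?thesis by simp
qed

text \<open>Identifies the closed form with the residue: the nodes of the own family give the sign
  and the two factorials, those of the other family the last Pochhammer symbol. The right side is
  symmetric in the two families, so one function on \<open>X\<close> serves both components.\<close>

lemma hahn_residue_eq:
  assumes "i < n" and disj: "\<And>i j. i < n \<Longrightarrow> j < n' \<Longrightarrow> \<alpha> + real i \<noteq> \<alpha>' + real j"
    and "X = (\<lambda>i. \<alpha> + real i) ` {..<n} \<union> (\<lambda>i. \<alpha>' + real i) ` {..<n'}"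
  shows "hahn_residue N \<beta> \<alpha> \<alpha>' n n' i = 1 / (pochhammer (\<alpha> + real i + \<beta> + real (n + n')) (N + 2 - (n + n'))
    * (\<Prod>y\<in>X - {\<alpha> + real i}. \<alpha> + real i - y))"
proof -
  have X: "X - {\<alpha> + real i} = (\<lambda>i. \<alpha> + real i) ` ({..<n} - {i}) \<union> (\<lambda>i. \<alpha>' + real i) ` {..<n'}"
    using disj assms(1) unfolding assms(3) by force
  have "(\<Prod>y\<in>X - {\<alpha> + real i}. \<alpha> + real i - y)
      = (\<Prod>y\<in>(\<lambda>i. \<alpha> + real i) ` ({..<n} - {i}). \<alpha> + real i - y) * (\<Prod>y\<in>(\<lambda>i. \<alpha>' + real i) ` {..<n'}. \<alpha> + real i - y)"
    unfolding X using disj by (intro prod.union_disjoint) auto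
  also have "(\<Prod>y\<in>(\<lambda>i. \<alpha> + real i) ` ({..<n} - {i}). \<alpha> + real i - y) = (\<Prod>j\<in>{..<n} - {i}. real i - real j)"
    by (subst prod.reindex) (auto simp: inj_on_def)
  also have "(\<Prod>y\<in>(\<lambda>i. \<alpha>' + real i) ` {..<n'}. \<alpha> + real i - y) = (\<Prod>j<n'. (\<alpha> + real i - \<alpha>') - real j)"
    by (subst prod.reindex) (auto simp: inj_on_def algebra_simps)
  also have "\<dots> = pochhammer (\<alpha> - \<alpha>' - real n' + 1 + real i) n'"
    by (simp only: prod_diff_pochhammer) (simp add: algebra_simps)
  also note prod_diff_index[OF assms(1)]
  finally have P: "(\<Prod>y\<in>X - {\<alpha> + real i}. \<alpha> + real i - y)
    = (-1) ^ (n - 1 - i) * fact i * fact (n - 1 - i) * pochhammer (\<alpha> - \<alpha>' - real n' + 1 + real i) n'" .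
  have e: "\<alpha> + real i + \<beta> + real (n + n') = \<alpha> + \<beta> + real n + real n' + real i" "N + 2 - (n + n') = N + 2 - n - n'"
    by auto
  have sgn: "s / (F1 * F2 * P * Q) = 1 / (P * (s * F1 * F2 * Q))" if "s * s = 1" for s F1 F2 P Q :: real
  proof -
    have "s = 1 / s" using that by (metis eq_divide_imp mult_zero_left zero_neq_one)
    then show ?thesis by (metis (no_types, lifting) divide_divide_eq_left mult.assoc mult.left_commute)
  qed
  show ?thesis
    unfolding hahn_residue_def P e by (rule sgn) (simp flip: power_mult_distrib)
qed

text \<open>This is \<open>divided_difference_polynomial\<close> for the constant 1 on
  \<open>insert t X\<close>: its coefficient of degree \<open>card X > 0\<close> is zero, and the
  summand at \<open>t\<close>, moved across, gives the right-hand side.\<close>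

lemma sum_reciprocal_simple_pole:
  fixes X :: "'a::field set"
  assumes "finite X" "X \<noteq> {}" "t \<notin> X"
  shows "(\<Sum>x\<in>X. 1 / ((x - t) * (\<Prod>y\<in>X - {x}. x - y))) = - 1 / (\<Prod>y\<in>X. t - y)"
proof -
  have c: "card (insert t X) = Suc (card X)" "card X > 0" using assms by (auto simp: card_gt_0_iff)
  have "(\<Sum>x\<in>insert t X. poly 1 x / (\<Prod>y\<in>insert t X - {x}. x - y)) = coeff (1 :: 'a poly) (card (insert t X) - 1)"
    using assms c by (intro divided_difference_polynomial) auto
  also have "\<dots> = 0" using c by (simp add: coeff_1)
  finally have "1 / (\<Prod>y\<in>X. t - y) + (\<Sum>x\<in>X. 1 / (\<Prod>y\<in>insert t X - {x}. x - y)) = 0"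
    using assms by simp
  moreover have "(\<Sum>x\<in>X. 1 / (\<Prod>y\<in>insert t X - {x}. x - y)) = (\<Sum>x\<in>X. 1 / ((x - t) * (\<Prod>y\<in>X - {x}. x - y)))"
  proof (intro sum.cong refl)
    fix x assume "x \<in> X"
    then have "insert t X - {x} = insert t (X - {x})" using assms by auto
    then show "1 / (\<Prod>y\<in>insert t X - {x}. x - y) = 1 / ((x - t) * (\<Prod>y\<in>X - {x}. x - y))"
      using assms by simp
  qed
  ultimately have "1 / (\<Prod>y\<in>X. t - y) + (\<Sum>x\<in>X. 1 / ((x - t) * (\<Prod>y\<in>X - {x}. x - y))) = 0"
    by (simp only:)
  from add.inverse_unique[OF this] show ?thesis by simp
qed

subsection \<open>Separation of the shifted parameters\<close>

lemma AT_system_commute: "AT_system N w1 w2 \<Longrightarrow> AT_system N w2 w1"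
proof -
  have "chebyshev_index N w2 w1 n2 n1" if "chebyshev_index N w1 w2 n1 n2" for n1 n2
    unfolding chebyshev_index_def
  proof (intro allI impI)
    fix p1 p2 :: "real poly"
    assume "p1 = 0 \<or> degree p1 < n2" "p2 = 0 \<or> degree p2 < n1" "(p1, p2) \<noteq> (0, 0)"
    with that[unfolded chebyshev_index_def, rule_format, of p2 p1]
    show "card {x \<in> {0..N}. poly p1 (real x) * w2 x + poly p2 (real x) * w1 x = 0} \<le> n2 + n1 - 1"
      by (auto simp: add.commute)
  qed
  then show "AT_system N w1 w2 \<Longrightarrow> AT_system N w2 w1"
    unfolding AT_system_def by blast
qed

lemma pochhammer_linear_poly:
  fixes c :: "'a::idom"
  obtains p where "degree p = d" "\<And>x. poly p x = pochhammer (x + c) d"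
proof
  let ?p = "\<Prod>i<d. [:c + of_nat i, 1:]"
  show "degree ?p = d" by (subst degree_prod_eq_sum_degree) auto
  show "poly ?p x = pochhammer (x + c) d" for x
    by (simp add: poly_prod pochhammer_prod atLeast0LessThan add_ac)
qed

text \<open>For \<open>\<alpha>' = \<alpha> + d\<close> the second weight is the first times a
  polynomial of degree \<open>d\<close>. At the index \<open>(d + 1, 1)\<close> this yields a
  nontrivial combination vanishing at all \<open>N + 1\<close> nodes, while at most
  \<open>d + 1 \<le> N\<close> zeros are allowed.\<close>

lemma AT_system_hahn_shift:
  assumes "\<alpha> > -1" "\<beta> > -1" "d < N" and AT: "AT_system N (hahn_weight N \<beta> \<alpha>) (hahn_weight N \<beta> \<alpha>')"
  shows "\<alpha>' \<noteq> \<alpha> + real d"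
proof
  assume \<alpha>': "\<alpha>' = \<alpha> + real d"
  obtain p where p: "degree p = d" "\<And>x. poly p x = pochhammer (x + (\<alpha> + 1)) d"
    using pochhammer_linear_poly[of d "\<alpha> + 1"] by blast
  let ?q = "smult (- 1 / pochhammer (\<alpha> + 1) d) p"
  have "degree ?q < d + 1" using p(1) by (simp add: degree_smult_eq)
  then have "card {x \<in> {0..N}. poly ?q (real x) * hahn_weight N \<beta> \<alpha> x + poly 1 (real x) * hahn_weight N \<beta> \<alpha>' x = 0}
      \<le> (d + 1) + 1 - 1"
    using AT[unfolded AT_system_def chebyshev_index_def, rule_format, of ?q "d + 1" 1 1] by simp
  moreover have "{x \<in> {0..N}. poly ?q (real x) * hahn_weight N \<beta> \<alpha> x + poly 1 (real x) * hahn_weight N \<beta> \<alpha>' x = 0} = {0..N}"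
    using assms(1,2) by (auto simp: \<alpha>' p(2) hahn_weight_add add_ac)
  ultimately show False using assms(3) by simp
qed

text \<open>A coincidence would make the parameters differ by the distance of \<open>i\<close> and
  \<open>j\<close>. Both \<open>n1\<close> and \<open>n2\<close> are positive here, so neither
  exceeds \<open>N\<close>; the distance is then less than \<open>N\<close> and
  \<open>AT_system_hahn_shift\<close> excludes it.\<close>

lemma hahn_nodes_distinct:
  assumes "\<alpha>1 > -1" "\<alpha>2 > -1" "\<beta> > -1" and "n1 + n2 \<le> N + 1"
    and "AT_system N (hahn_weight N \<beta> \<alpha>1) (hahn_weight N \<beta> \<alpha>2)" and "i < n1" "j < n2"
  shows "\<alpha>1 + real i \<noteq> \<alpha>2 + real j"
proof (cases "i \<le> j")
  case True
  then have "\<alpha>1 \<noteq> \<alpha>2 + real (j - i)"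
    using AT_system_hahn_shift[OF assms(2,3) _ AT_system_commute[OF assms(5)], of "j - i"] assms by simp
  with True show ?thesis by (simp add: of_nat_diff)
next
  case False
  then have "\<alpha>2 \<noteq> \<alpha>1 + real (i - j)"
    using AT_system_hahn_shift[OF assms(1,3) _ assms(5), of "i - j"] assms by simp
  with False show ?thesis by (simp add: of_nat_diff)
qed

text \<open>A vanishing factor says \<open>\<alpha> + k = \<alpha>' + (n' - 1)\<close> for some
  \<open>k < n + n' - 1\<close>. Cancelling the smaller of \<open>k\<close> and
  \<open>n' - 1\<close> produces two coinciding nodes, one of them with shift 0.\<close>

lemma hahn_denominator_nonzero:
  assumes "\<And>i j. i < n \<Longrightarrow> j < n' \<Longrightarrow> \<alpha> + real i \<noteq> \<alpha>' + real j" and "1 \<le> n" "1 \<le> n'"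
  shows "pochhammer (\<alpha> - \<alpha>' - real n' + 1) (n + n' - 1) \<noteq> 0"
proof
  assume "pochhammer (\<alpha> - \<alpha>' - real n' + 1) (n + n' - 1) = 0"
  then obtain k where k: "k < n + n' - 1" "\<alpha> - \<alpha>' - real n' + 1 = - real k"
    by (auto simp: pochhammer_eq_0_iff)
  show False
  proof (cases "n' - 1 \<le> k")
    case True
    then have "k - (n' - 1) < n" "real (k - (n' - 1)) = real k - real n' + 1"
      using assms(2,3) k(1) by (auto simp: of_nat_diff)
    then show False
      using assms(1)[of "k - (n' - 1)" 0] assms(3) k(2) by simp
  next
    case False
    then show False
      using assms(1)[of 0 "n' - 1 - k"] assms(2,3) k by (simp add: of_nat_diff)
  qed
qed

subsection \<open>Moments of the linear form\<close>

lemma hahn_norm_commute: "hahn_norm N \<beta> \<alpha>' \<alpha> n' n = hahn_norm N \<beta> \<alpha> \<alpha>' n n'"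
proof -
  have "N + 1 - n' - n = N + 1 - n - n'" by simp
  then show ?thesis by (simp add: hahn_norm_def add_ac mult_ac)
qed

text \<open>Both components carry the same factor \<open>hahn_norm\<close> and the same function
  \<open>g\<close>, so their expansions in shifted weights merge into one sum over the disjoint
  union \<open>X\<close>; \<open>hahn_weight_moment\<close> then evaluates each moment.\<close>

lemma hahn_linear_form_moment:
  assumes "\<alpha>1 > -1" "\<alpha>2 > -1" "\<beta> > -1" and "2 \<le> n1 + n2" "n1 + n2 \<le> N + 1" and "j \<le> N"
    and distinct: "\<forall>i<n1. \<forall>j<n2. \<alpha>1 + real i \<noteq> \<alpha>2 + real j"
    and X: "X = (\<lambda>i. \<alpha>1 + real i) ` {..<n1} \<union> (\<lambda>i. \<alpha>2 + real i) ` {..<n2}"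
  shows "(\<Sum>k = 0..N. (hahn_Q N \<beta> \<alpha>1 \<alpha>2 n1 n2 (real k) * hahn_weight N \<beta> \<alpha>1 k
                     + hahn_Q N \<beta> \<alpha>2 \<alpha>1 n2 n1 (real k) * hahn_weight N \<beta> \<alpha>2 k)
                    * pochhammer (- real N + real k) j)
    = hahn_norm N \<beta> \<alpha>1 \<alpha>2 n1 n2 * (\<Sum>x\<in>X. 1 / (pochhammer (x + \<beta> + real (n1 + n2)) (N + 2 - (n1 + n2))
          * (\<Prod>y\<in>X - {x}. x - y)) * ((-1) ^ j * pochhammer (\<beta> + 1) j * pochhammer (x + \<beta> + 2 + real j) (N - j) / fact (N - j)))"
proof -
  let ?G = "hahn_norm N \<beta> \<alpha>1 \<alpha>2 n1 n2"
  let ?m = "\<lambda>t. \<Sum>k = 0..N. hahn_weight N \<beta> t k * pochhammer (- real N + real k) j"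
  define g where "g x = 1 / (pochhammer (x + \<beta> + real (n1 + n2)) (N + 2 - (n1 + n2)) * (\<Prod>y\<in>X - {x}. x - y))" for x
  have disj: "\<alpha>1 + real i \<noteq> \<alpha>2 + real j" if "i < n1" "j < n2" for i j
    using distinct that by blast
  have disj': "\<alpha>2 + real i \<noteq> \<alpha>1 + real j" if "i < n2" "j < n1" for i j
    using disj[of j i] that by simp
  have r1: "hahn_residue N \<beta> \<alpha>1 \<alpha>2 n1 n2 i = g (\<alpha>1 + real i)" if "i < n1" for i
    unfolding g_def using that disj X by (rule hahn_residue_eq)
  have X': "X = (\<lambda>i. \<alpha>2 + real i) ` {..<n2} \<union> (\<lambda>i. \<alpha>1 + real i) ` {..<n1}" using X by auto
  have r2: "hahn_residue N \<beta> \<alpha>2 \<alpha>1 n2 n1 i = g (\<alpha>2 + real i)" if "i < n2" for i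
    unfolding g_def using hahn_residue_eq[OF that disj' X'] by (simp only: add.commute[of n2 n1])
  have Q1: "hahn_Q N \<beta> \<alpha>1 \<alpha>2 n1 n2 (real k) * hahn_weight N \<beta> \<alpha>1 k
      = ?G * (\<Sum>i<n1. g (\<alpha>1 + real i) * hahn_weight N \<beta> (\<alpha>1 + real i) k)" if "k \<le> N" for k
    using hahn_Q_times_weight[OF assms(1-5) that hahn_denominator_nonzero[OF disj]]
    by (simp add: r1)
  have Q2: "hahn_Q N \<beta> \<alpha>2 \<alpha>1 n2 n1 (real k) * hahn_weight N \<beta> \<alpha>2 k
      = ?G * (\<Sum>i<n2. g (\<alpha>2 + real i) * hahn_weight N \<beta> (\<alpha>2 + real i) k)" if "k \<le> N" for k
    using hahn_Q_times_weight[OF assms(2,1,3) _ _ that hahn_denominator_nonzero[OF disj']] assms(4,5)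
    by (simp add: r2 add.commute[of n2 n1] hahn_norm_commute[of N \<beta> \<alpha>2 \<alpha>1 n2 n1])
  have part: "(\<Sum>k = 0..N. (\<Sum>i<n. g (\<alpha> + real i) * hahn_weight N \<beta> (\<alpha> + real i) k) * pochhammer (- real N + real k) j)
      = (\<Sum>x\<in>(\<lambda>i. \<alpha> + real i) ` {..<n}. g x * ?m x)" for \<alpha> n
  proof -
    have "(\<Sum>k = 0..N. (\<Sum>i<n. g (\<alpha> + real i) * hahn_weight N \<beta> (\<alpha> + real i) k) * pochhammer (- real N + real k) j)
      = (\<Sum>i<n. g (\<alpha> + real i) * ?m (\<alpha> + real i))"
      unfolding sum_distrib_left sum_distrib_right mult.assoc by (rule sum.swap)
    then show ?thesis by (subst sum.reindex) (auto simp: inj_on_def)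
  qed
  have "(\<Sum>k = 0..N. (hahn_Q N \<beta> \<alpha>1 \<alpha>2 n1 n2 (real k) * hahn_weight N \<beta> \<alpha>1 k
                     + hahn_Q N \<beta> \<alpha>2 \<alpha>1 n2 n1 (real k) * hahn_weight N \<beta> \<alpha>2 k)
                    * pochhammer (- real N + real k) j)
    = (\<Sum>k = 0..N. ?G * ((\<Sum>i<n1. g (\<alpha>1 + real i) * hahn_weight N \<beta> (\<alpha>1 + real i) k) * pochhammer (- real N + real k) j)
         + ?G * ((\<Sum>i<n2. g (\<alpha>2 + real i) * hahn_weight N \<beta> (\<alpha>2 + real i) k) * pochhammer (- real N + real k) j))"
    by (intro sum.cong refl) (simp only: Q1 Q2 atLeastAtMost_iff distrib_right mult.assoc)
  also have "\<dots> = ?G * ((\<Sum>x\<in>(\<lambda>i. \<alpha>1 + real i) ` {..<n1}. g x * ?m x) + (\<Sum>x\<in>(\<lambda>i. \<alpha>2 + real i) ` {..<n2}. g x * ?m x))"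
    unfolding sum.distrib by (simp only: part distrib_left flip: sum_distrib_left)
  also have "(\<Sum>x\<in>(\<lambda>i. \<alpha>1 + real i) ` {..<n1}. g x * ?m x) + (\<Sum>x\<in>(\<lambda>i. \<alpha>2 + real i) ` {..<n2}. g x * ?m x)
      = (\<Sum>x\<in>X. g x * ?m x)"
    unfolding X using disj by (intro sum.union_disjoint[symmetric]) auto
  also have "\<dots> = (\<Sum>x\<in>X. g x * ((-1) ^ j * pochhammer (\<beta> + 1) j * pochhammer (x + \<beta> + 2 + real j) (N - j) / fact (N - j)))"
  proof (intro sum.cong refl)
    fix x assume "x \<in> X"
    then have "x > -1" unfolding X using assms(1,2) by auto
    from hahn_weight_moment[OF this assms(3,6)]
    show "g x * ?m x = g x * ((-1) ^ j * pochhammer (\<beta> + 1) j * pochhammer (x + \<beta> + 2 + real j) (N - j) / fact (N - j))"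
      by (simp only:)
  qed
  finally show ?thesis unfolding g_def .
qed

theorem proposition2p3:
  fixes N n1 n2 :: nat and \<alpha>1 \<alpha>2 \<beta> :: real
  assumes "\<alpha>1 > -1" and "\<alpha>2 > -1" and "\<beta> > -1"
    and "1 \<le> n1 + n2" and "n1 + n2 \<le> N + 1"
    and "AT_system N (hahn_weight N \<beta> \<alpha>1) (hahn_weight N \<beta> \<alpha>2)"
  shows "(\<forall>j. j + 2 \<le> n1 + n2 \<longrightarrow>
            (\<Sum>k = 0..N. (hahn_Q N \<beta> \<alpha>1 \<alpha>2 n1 n2 (real k) * hahn_weight N \<beta> \<alpha>1 k
                        + hahn_Q N \<beta> \<alpha>2 \<alpha>1 n2 n1 (real k) * hahn_weight N \<beta> \<alpha>2 k)
                       * pochhammer (- real N + real k) j) = 0)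
       \<and> (\<Sum>k = 0..N. (hahn_Q N \<beta> \<alpha>1 \<alpha>2 n1 n2 (real k) * hahn_weight N \<beta> \<alpha>1 k
                     + hahn_Q N \<beta> \<alpha>2 \<alpha>1 n2 n1 (real k) * hahn_weight N \<beta> \<alpha>2 k)
                    * pochhammer (- real N + real k) (n1 + n2 - 1)) = 1"
proof (cases "n1 + n2 = 1")
  \<comment> \<open>here \<open>\<alpha> + \<beta> + n\<^sub>1 + n\<^sub>2\<close> may vanish, so the residues are not available\<close>
  case True
  \<comment> \<open>The polynomial is the constant
    \<open>fact N / pochhammer (\<alpha> + \<beta> + 2) N\<close>, the reciprocal of the total mass
    of the weight.\<close>
  have mass: "(\<Sum>k = 0..N. hahn_Q N \<beta> \<alpha> \<alpha>' 1 0 (real k) * hahn_weight N \<beta> \<alpha> k) = 1"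
    if "\<alpha> > -1" for \<alpha> \<alpha>'
  proof -
    have "\<alpha> + \<beta> + 2 > 0" using that assms(3) by simp
    then have "pochhammer (\<alpha> + \<beta> + 2) N > 0" by (rule pochhammer_pos)
    then show ?thesis
      using hahn_weight_moment[OF that assms(3), of 0 N]
      by (simp add: hahn_Q_def hahn_C0_def flip: sum_distrib_left sum_divide_distrib)
  qed
  from True consider "n1 = 1" "n2 = 0" | "n1 = 0" "n2 = 1" by linarith
  then show ?thesis
  proof cases
    case 1
    then show ?thesis using mass[OF assms(1), of \<alpha>2] by (simp add: hahn_Q_def)
  next
    case 2
    then show ?thesis using mass[OF assms(2), of \<alpha>1] by (simp add: hahn_Q_def)
  qed
next
  case False
  define M where "M = n1 + n2 - 1"
  define X where "X = (\<lambda>i. \<alpha>1 + real i) ` {..<n1} \<union> (\<lambda>i. \<alpha>2 + real i) ` {..<n2}"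
  \<comment> \<open>The zero in \<open>x\<close> of the first factor of \<open>pochhammer (x +
    \<beta> + real (n1 + n2)) (N + 2 - (n1 + n2))\<close>, the one pole outside \<open>X\<close>
    that survives in the moment \<open>j = M\<close>.\<close>
  define t where "t = - \<beta> - real (n1 + n2)"
  have M: "n1 + n2 = M + 1" "M \<ge> 1" "M \<le> N" using False assms(4,5) by (auto simp: M_def)
  have disj: "\<alpha>1 + real i \<noteq> \<alpha>2 + real j" if "i < n1" "j < n2" for i j
    using hahn_nodes_distinct[OF assms(1-3,5,6) that] .
  have fin: "finite X" by (simp add: X_def)
  have card: "card X = M + 1"
  proof -
    have "card X = card ((\<lambda>i. \<alpha>1 + real i) ` {..<n1}) + card ((\<lambda>i. \<alpha>2 + real i) ` {..<n2})"
      unfolding X_def using disj by (intro card_Un_disjoint) auto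
    then show ?thesis using M(1) by (simp add: card_image inj_on_def)
  qed
  have pos: "x - t > 0" if "x \<in> X" for x
    using that assms(1-3) M unfolding X_def t_def by auto
  have shift: "x + \<beta> + real (n1 + n2) = x - t" for x by (simp add: t_def)
  have n2: "2 \<le> n1 + n2" using M by simp
  have distinct: "\<forall>i<n1. \<forall>j<n2. \<alpha>1 + real i \<noteq> \<alpha>2 + real j" using disj by blast
  note form = hahn_linear_form_moment[OF assms(1-3) n2 assms(5) _ distinct X_def, unfolded shift]
  show ?thesis
  proof (intro conjI allI impI)
    fix j assume "j + 2 \<le> n1 + n2"
    then have j: "j \<le> N" "j < M" using M by auto
    obtain p where p: "degree p = M - 1 - j" "\<And>x. poly p x = pochhammer (x + (\<beta> + 2 + real j)) (M - 1 - j)"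
      using pochhammer_linear_poly[of "M - 1 - j" "\<beta> + 2 + real j"] by blast
    \<comment> \<open>Both Pochhammer symbols end with the factor
      \<open>x + \<beta> + N + 1\<close>. Cancelling the denominator leaves \<open>poly p x\<close>
      of degree \<open>M - 1 - j\<close>, too low for a nonzero coefficient at
      \<open>card X - 1 = M\<close>.\<close>
    have summand: "1 / (pochhammer (x - t) (N + 2 - (n1 + n2)) * P) * (c * pochhammer (x + \<beta> + 2 + real j) (N - j) / f)
        = c / f * (poly p x / P)" if "x \<in> X" for x P c f
    proof -
      have "N - j = (M - 1 - j) + (N + 2 - (n1 + n2))" using j M by simp
      moreover have "x + \<beta> + 2 + real j + real (M - 1 - j) = x - t"
        using j M by (simp add: t_def of_nat_diff)
      ultimately have "pochhammer (x + \<beta> + 2 + real j) (N - j) = poly p x * pochhammer (x - t) (N + 2 - (n1 + n2))"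
        unfolding p(2) by (simp only: pochhammer_product' add.assoc)
      moreover have "pochhammer (x - t) (N + 2 - (n1 + n2)) > 0" using pos[OF that] by (rule pochhammer_pos)
      ultimately show ?thesis by simp
    qed
    have "(\<Sum>x\<in>X. poly p x / (\<Prod>y\<in>X - {x}. x - y)) = coeff p M"
      using divided_difference_polynomial[OF fin, of p] p(1) card by simp
    also have "\<dots> = 0" using p(1) j by (intro coeff_eq_0) simp
    finally have "(\<Sum>x\<in>X. poly p x / (\<Prod>y\<in>X - {x}. x - y)) = 0" .
    then show "(\<Sum>k = 0..N. (hahn_Q N \<beta> \<alpha>1 \<alpha>2 n1 n2 (real k) * hahn_weight N \<beta> \<alpha>1 k
                        + hahn_Q N \<beta> \<alpha>2 \<alpha>1 n2 n1 (real k) * hahn_weight N \<beta> \<alpha>2 k)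
                       * pochhammer (- real N + real k) j) = 0"
      unfolding form[OF j(1)] by (simp only: summand mult_zero_right cong: sum.cong flip: sum_distrib_left)
  next
    \<comment> \<open>Here the numerator starts at \<open>x - t + 1\<close>, one factor after the
      denominator, so \<open>1 / (x - t)\<close> is left over.\<close>
    have summand: "1 / (pochhammer (x - t) (N + 2 - (n1 + n2)) * P) * (c * pochhammer (x + \<beta> + 2 + real M) (N - M) / f)
        = c / f * (1 / ((x - t) * P))" if "x \<in> X" for x P c f
    proof -
      have "N + 2 - (n1 + n2) = Suc (N - M)" using M by simp
      moreover have "x + \<beta> + 2 + real M = x - t + 1" using M(1) by (simp add: t_def)
      ultimately have "pochhammer (x - t) (N + 2 - (n1 + n2)) = (x - t) * pochhammer (x + \<beta> + 2 + real M) (N - M)"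
        by (simp only: pochhammer_rec)
      moreover have "pochhammer (x - t) (N + 2 - (n1 + n2)) > 0" using pos[OF that] by (rule pochhammer_pos)
      ultimately show ?thesis by auto
    qed
    have "t \<notin> X" using pos by force
    have "X \<noteq> {}" using card by auto
    \<comment> \<open>Reversing \<open>M + 1\<close> differences gives a sign that compensates the
      \<open>(-1)^M\<close> of the moment together with the minus of
      \<open>sum_reciprocal_simple_pole\<close>.\<close>
    have "(\<Prod>y\<in>X. t - y) = (-1) ^ (M + 1) * (\<Prod>y\<in>X. y - t)"
    proof -
      have "(\<Prod>y\<in>X. t - y) = (\<Prod>y\<in>X. (-1) * (y - t))" by (intro prod.cong) auto
      then show ?thesis by (simp only: prod.distrib prod_constant card)
    qed
    also have "(\<Prod>y\<in>X. y - t) = pochhammer (\<alpha>1 + \<beta> + real n1 + real n2) n1 * pochhammer (\<alpha>2 + \<beta> + real n1 + real n2) n2"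
    proof -
      have "(\<Prod>y\<in>X. y - t) = (\<Prod>y\<in>(\<lambda>i. \<alpha>1 + real i) ` {..<n1}. y - t) * (\<Prod>y\<in>(\<lambda>i. \<alpha>2 + real i) ` {..<n2}. y - t)"
        unfolding X_def using disj by (intro prod.union_disjoint) auto
      moreover have "(\<Prod>y\<in>(\<lambda>i. \<alpha> + real i) ` {..<n}. y - t) = pochhammer (\<alpha> + \<beta> + real n1 + real n2) n" for \<alpha> n
        by (subst prod.reindex) (auto simp: inj_on_def pochhammer_prod atLeast0LessThan t_def algebra_simps)
      ultimately show ?thesis by simp
    qed
    finally have P: "(\<Prod>y\<in>X. t - y)
      = (-1) ^ (M + 1) * (pochhammer (\<alpha>1 + \<beta> + real n1 + real n2) n1 * pochhammer (\<alpha>2 + \<beta> + real n1 + real n2) n2)" .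
    have p0: "pochhammer (\<alpha> + \<beta> + real n1 + real n2) n > 0" if "\<alpha> > -1" for \<alpha> n
      using that assms(3) M by (intro pochhammer_pos) simp
    have b0: "pochhammer (\<beta> + 1) M > 0" using assms(3) by (intro pochhammer_pos) simp
    have G: "hahn_norm N \<beta> \<alpha>1 \<alpha>2 n1 n2 = pochhammer (\<alpha>1 + \<beta> + real n1 + real n2) n1
        * pochhammer (\<alpha>2 + \<beta> + real n1 + real n2) n2 * fact (N - M) / pochhammer (\<beta> + 1) M"
    proof -
      have "N + 1 - n1 - n2 = N - M" using M(1) by simp
      then show ?thesis by (simp only: hahn_norm_def M_def)
    qed
    have "(\<Sum>k = 0..N. (hahn_Q N \<beta> \<alpha>1 \<alpha>2 n1 n2 (real k) * hahn_weight N \<beta> \<alpha>1 k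
                     + hahn_Q N \<beta> \<alpha>2 \<alpha>1 n2 n1 (real k) * hahn_weight N \<beta> \<alpha>2 k)
                    * pochhammer (- real N + real k) M)
      = hahn_norm N \<beta> \<alpha>1 \<alpha>2 n1 n2 * ((-1) ^ M * pochhammer (\<beta> + 1) M / fact (N - M) * (- 1 / (\<Prod>y\<in>X. t - y)))"
      unfolding form[OF M(3)] sum_reciprocal_simple_pole[OF fin \<open>X \<noteq> {}\<close> \<open>t \<notin> X\<close>, symmetric]
      by (simp only: summand cong: sum.cong flip: sum_distrib_left)
    also have "\<dots> = 1"
      unfolding P G using p0[OF assms(1), of n1] p0[OF assms(2), of n2] b0 by simp
    finally show "(\<Sum>k = 0..N. (hahn_Q N \<beta> \<alpha>1 \<alpha>2 n1 n2 (real k) * hahn_weight N \<beta> \<alpha>1 k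
                     + hahn_Q N \<beta> \<alpha>2 \<alpha>1 n2 n1 (real k) * hahn_weight N \<beta> \<alpha>2 k)
                    * pochhammer (- real N + real k) (n1 + n2 - 1)) = 1"
      unfolding M_def .
  qed
qed

end
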